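(* Let $q_1,\dots,q_d>0$, let $K\subset\mathbb{R}^d$ be a rectangular box with side lengths $2\pi/q_1,\dots,2\pi/q_d$ (sides parallel to the coordinate axes), and let $V$ be a real, bounded measurable function on $\mathbb{R}^d$, periodic with fundamental domain $K$. Let $H=-\Delta+V(\mathbf{x})$ on $L^2(K)$ with periodic boundary conditions, with eigenvalues $\lambda_1\le\lambda_2\le\cdots$ and an orthonormal basis of eigenfunctions $\{\phi_j\}$. Put $g:=\frac1d\sum_{\ell=1}^d q_\ell^2$, $V_j:=\langle\phi_j,V\phi_j\rangle$, and $$\overline{\lambda_N}:=\frac1N\sum_{j\le N}\lambda_j,\quad \overline{\lambda_N^2}:=\frac1N\sum_{j\le N}\lambda_j^2,\quad \overline{V_N}:=\frac1N\sum_{j\le N}V_j,\quad \overline{\lambda V_N}:=\frac1N\sum_{j\le N}\lambda_jV_j.$$ Then for every $N\ge1$ the quantity $$\mathfrak{D}_N:=\left(\left(1+\frac2d\right)\overline{\lambda_N}+\frac g2-\frac2d\overline{V_N}\right)^2-\left(1+\frac4d\right)\overline{\lambda_N^2}-g\,\overline{\lambda_N}+\frac4d\,\overline{\lambda V_N}$$ is nonnegative, and $$\lambda_{N+1}\le\left(1+\frac2d\right)\overline{\lambda_N}+\frac g2-\frac2d\overline{V_N}+\sqrt{\mathfrak{D}_N}.$$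
   Context: Eigenvalues are counted with multiplicity; inner products are in $L^2(K)$. *)

theory Defs
  imports "HOL-Analysis.Analysis"
begin

text \<open>Elements of \<open>L\<^sup>2(K)\<close> are represented by complex-valued functions; only their
  restriction to \<open>K\<close>, up to null sets, matters.\<close>

definition L2 :: "(real ^ 'n) set \<Rightarrow> (real ^ 'n \<Rightarrow> complex) set" where
  "L2 K = {f. f \<in> borel_measurable (lebesgue_on K) \<and>
              integrable (lebesgue_on K) (\<lambda>x. (cmod (f x))\<^sup>2)}"

definition L2_inner :: "(real ^ 'n) set \<Rightarrow> (real ^ 'n \<Rightarrow> complex) \<Rightarrow> (real ^ 'n \<Rightarrow> complex) \<Rightarrow> complex" where
  "L2_inner K f g = (LINT x|lebesgue_on K. cnj (f x) * g x)"

definition L2_norm :: "(real ^ 'n) set \<Rightarrow> (real ^ 'n \<Rightarrow> complex) \<Rightarrow> real" where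
  "L2_norm K f = sqrt (LINT x|lebesgue_on K. (cmod (f x))\<^sup>2)"

text \<open>Sequences are indexed from 1; the value at index 0 is irrelevant.\<close>

definition orthonormal_basis :: "(real ^ 'n) set \<Rightarrow> (nat \<Rightarrow> real ^ 'n \<Rightarrow> complex) \<Rightarrow> bool" where
  "orthonormal_basis K \<phi> \<longleftrightarrow>
     (\<forall>j\<ge>1. \<phi> j \<in> L2 K) \<and>
     (\<forall>j\<ge>1. \<forall>k\<ge>1. L2_inner K (\<phi> j) (\<phi> k) = (if j = k then 1 else 0)) \<and>
     (\<forall>f\<in>L2 K. (\<lambda>n. L2_norm K (\<lambda>x. f x - (\<Sum>j=1..n. L2_inner K (\<phi> j) f * \<phi> j x))) \<longlonglongrightarrow> 0)"

definition periodic :: "real ^ 'n \<Rightarrow> (real ^ 'n \<Rightarrow> 'a) \<Rightarrow> bool" where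
  "periodic q f \<longleftrightarrow> (\<forall>x i. f (x + axis i (2 * pi / q $ i)) = f x)"

definition partial_deriv :: "'n \<Rightarrow> (real ^ 'n \<Rightarrow> complex) \<Rightarrow> real ^ 'n \<Rightarrow> complex" where
  "partial_deriv i f x = frechet_derivative f (at x) (axis i 1)"

primrec C_k :: "nat \<Rightarrow> (real ^ 'n \<Rightarrow> complex) \<Rightarrow> bool" where
  "C_k 0 f \<longleftrightarrow> continuous_on UNIV f"
| "C_k (Suc k) f \<longleftrightarrow> f differentiable_on UNIV \<and> (\<forall>i. C_k k (partial_deriv i f))"

definition smooth :: "(real ^ 'n \<Rightarrow> complex) \<Rightarrow> bool" where
  "smooth f \<longleftrightarrow> (\<forall>k. C_k k f)"

text \<open>Weak derivatives on the torus. The test functions are periodic and need not vanish on the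
  boundary of \<open>K\<close>; this is what imposes periodic boundary conditions on \<open>u\<close>.\<close>

definition weak_partial_deriv ::
  "(real ^ 'n) set \<Rightarrow> real ^ 'n \<Rightarrow> 'n \<Rightarrow> (real ^ 'n \<Rightarrow> complex) \<Rightarrow> (real ^ 'n \<Rightarrow> complex) \<Rightarrow> bool" where
  "weak_partial_deriv K q i u v \<longleftrightarrow> u \<in> L2 K \<and> v \<in> L2 K \<and>
     (\<forall>\<psi>. smooth \<psi> \<and> periodic q \<psi> \<longrightarrow>
        (LINT x|lebesgue_on K. u x * partial_deriv i \<psi> x) = - (LINT x|lebesgue_on K. v x * \<psi> x))"

text \<open>The Sobolev spaces \<open>H\<^sup>m\<close> of periodic functions.\<close>

primrec sobolev_per :: "(real ^ 'n) set \<Rightarrow> real ^ 'n \<Rightarrow> nat \<Rightarrow> (real ^ 'n \<Rightarrow> complex) set" where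
  "sobolev_per K q 0 = L2 K"
| "sobolev_per K q (Suc m) =
     {u \<in> L2 K. \<forall>i. \<exists>v \<in> sobolev_per K q m. weak_partial_deriv K q i u v}"

definition has_weak_laplacian ::
  "(real ^ 'n) set \<Rightarrow> real ^ 'n \<Rightarrow> (real ^ 'n \<Rightarrow> complex) \<Rightarrow> (real ^ 'n \<Rightarrow> complex) \<Rightarrow> bool" where
  "has_weak_laplacian K q u w \<longleftrightarrow>
     (\<exists>v z. (\<forall>i. weak_partial_deriv K q i u (v i) \<and> weak_partial_deriv K q i (v i) (z i)) \<and>
            (AE x in lebesgue_on K. w x = (\<Sum>i\<in>UNIV. z i x)))"

text \<open>The graph of \<open>H = -\<Delta> + V\<close> with periodic boundary conditions, whose domain is the periodic
  Sobolev space of order 2. It is given as a relation between \<open>u\<close> and \<open>H u\<close> because \<open>H u\<close> is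
  determined only up to null sets.\<close>

definition schroedinger_per ::
  "(real ^ 'n) set \<Rightarrow> real ^ 'n \<Rightarrow> (real ^ 'n \<Rightarrow> real) \<Rightarrow>
   (real ^ 'n \<Rightarrow> complex) \<Rightarrow> (real ^ 'n \<Rightarrow> complex) \<Rightarrow> bool" where
  "schroedinger_per K q V u f \<longleftrightarrow> u \<in> sobolev_per K q 2 \<and>
     (\<exists>w. has_weak_laplacian K q u w \<and>
          (AE x in lebesgue_on K. f x = - w x + complex_of_real (V x) * u x))"

definition average :: "nat \<Rightarrow> (nat \<Rightarrow> real) \<Rightarrow> real" where
  "average N s = (1 / real N) * (\<Sum>j=1..N. s j)"

end

theory Submission
  imports Defs
begin

text \<open>
  For a box \<open>K\<close> and a coordinate direction \<open>l\<close> let \<open>G\<close> be multiplication by the plane wave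
  \<open>exp (i q\<^sub>l x\<^sub>l)\<close>, which respects the periodicity. Then \<open>[H, G] = G (q\<^sub>l\<^sup>2 - 2 i q\<^sub>l \<partial>\<^sub>l)\<close>, and its matrix
  elements in the eigenbasis are \<open>(\<lambda>\<^sub>k - \<lambda>\<^sub>j) G\<^sub>k\<^sub>j\<close> (lemma \<open>commutator_matrix_element\<close>). Put
  \<open>S\<^sub>j\<^sub>k = \<bar>G\<^sub>k\<^sub>j\<bar>\<^sup>2 + \<bar>G\<^sub>j\<^sub>k\<bar>\<^sup>2\<close>, which combines \<open>G\<close> with its adjoint. Parseval's identity gives the sum rules
  \<open>\<Sum>\<^sub>k (\<lambda>\<^sub>k - \<lambda>\<^sub>j) S\<^sub>j\<^sub>k = 2 q\<^sub>l\<^sup>2\<close> and \<open>\<Sum>\<^sub>k (\<lambda>\<^sub>k - \<lambda>\<^sub>j)\<^sup>2 S\<^sub>j\<^sub>k = 2 q\<^sub>l\<^sup>4 + 8 q\<^sub>l\<^sup>2 \<parallel>\<partial>\<^sub>l \<phi>\<^sub>j\<parallel>\<^sup>2\<close>.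
  For \<open>z\<close> between \<open>\<lambda>\<^sub>N\<close> and \<open>\<lambda>\<^sub>N\<^sub>+\<^sub>1\<close> the symmetry of \<open>S\<close> then yields
  \<open>\<Sum>\<^sub>j\<^sub>\<le>\<^sub>N (z - \<lambda>\<^sub>j)\<^sup>2 \<le> \<Sum>\<^sub>j\<^sub>\<le>\<^sub>N (z - \<lambda>\<^sub>j) (q\<^sub>l\<^sup>2 + 4 \<parallel>\<partial>\<^sub>l \<phi>\<^sub>j\<parallel>\<^sup>2)\<close>
  (lemmas \<open>symmetric_moment_inequality\<close> and \<open>direction_inequality\<close>). Summed over \<open>l\<close>, with
  \<open>\<parallel>\<nabla>\<phi>\<^sub>j\<parallel>\<^sup>2 = \<lambda>\<^sub>j - V\<^sub>j\<close>, this is a quadratic inequality in \<open>z\<close>; at \<open>z = \<lambda>\<^sub>N\<^sub>+\<^sub>1\<close> it says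
  that the discriminant is nonnegative and that \<open>\<lambda>\<^sub>N\<^sub>+\<^sub>1\<close> is at most the larger root.

  The analytic difficulty is that derivatives are weak, so that integration by parts is given only
  against smooth periodic functions, whereas the commutator identity needs it between eigenfunctions. It
  is obtained by Fourier series: a weak derivative multiplies the Fourier coefficients by \<open>i \<xi>\<^sub>l\<close>
  (lemma \<open>weak_partial_deriv_coeff\<close>), and operators with conjugate multipliers are adjoint
  (lemma \<open>multiplier_adjoint\<close>) because the plane waves are complete in \<open>L\<^sup>2(K)\<close>
  (theorem \<open>L2_approximable\<close>).
\<close>

section \<open>The space of square integrable functions\<close>

definition normsq :: "(real ^ 'n) set \<Rightarrow> (real ^ 'n \<Rightarrow> complex) \<Rightarrow> real" where
  "normsq K f = (LINT x|lebesgue_on K. (cmod (f x))\<^sup>2)"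

lemma normsq_nonneg: "0 \<le> normsq K f"
  by (simp add: normsq_def)

lemma L2_measurable: "f \<in> L2 K \<Longrightarrow> f \<in> borel_measurable (lebesgue_on K)"
  and L2_integrable: "f \<in> L2 K \<Longrightarrow> integrable (lebesgue_on K) (\<lambda>x. (cmod (f x))\<^sup>2)"
  by (simp_all add: L2_def)

lemma L2_dominated:
  assumes "f \<in> L2 K" and "g \<in> borel_measurable (lebesgue_on K)"
    and "\<And>x. x \<in> space (lebesgue_on K) \<Longrightarrow> cmod (g x) \<le> B * cmod (f x)"
  shows "g \<in> L2 K"
proof -
  have "integrable (lebesgue_on K) (\<lambda>x. B\<^sup>2 * (cmod (f x))\<^sup>2)"
    using L2_integrable[OF assms(1)] by simp
  then have "integrable (lebesgue_on K) (\<lambda>x. (cmod (g x))\<^sup>2)"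
  proof (rule Bochner_Integration.integrable_bound)
    show "(\<lambda>x. (cmod (g x))\<^sup>2) \<in> borel_measurable (lebesgue_on K)"
      using assms(2) by measurable
    show "AE x in lebesgue_on K. norm ((cmod (g x))\<^sup>2) \<le> norm (B\<^sup>2 * (cmod (f x))\<^sup>2)"
    proof (rule AE_I2)
      fix x assume "x \<in> space (lebesgue_on K)"
      then have "(cmod (g x))\<^sup>2 \<le> (B * cmod (f x))\<^sup>2"
        using assms(3) by (intro power_mono) auto
      then show "norm ((cmod (g x))\<^sup>2) \<le> norm (B\<^sup>2 * (cmod (f x))\<^sup>2)"
        by (simp add: power_mult_distrib)
    qed
  qed
  with assms(2) show ?thesis by (simp add: L2_def)
qed

lemma cmod_add_squared_le: "(cmod (u + v))\<^sup>2 \<le> 2 * (cmod u)\<^sup>2 + 2 * (cmod v)\<^sup>2"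
proof -
  have "(cmod (u + v))\<^sup>2 \<le> (cmod u + cmod v)\<^sup>2"
    by (intro power_mono norm_triangle_ineq) simp
  also have "\<dots> \<le> 2 * (cmod u)\<^sup>2 + 2 * (cmod v)\<^sup>2"
    using zero_le_power2[of "cmod u - cmod v"]
    by (simp add: power2_eq_square algebra_simps)
  finally show ?thesis .
qed

lemma L2_add:
  assumes "f \<in> L2 K" "g \<in> L2 K"
  shows "(\<lambda>x. f x + g x) \<in> L2 K"
proof -
  have "integrable (lebesgue_on K) (\<lambda>x. 2 * (cmod (f x))\<^sup>2 + 2 * (cmod (g x))\<^sup>2)"
    using assms[THEN L2_integrable] by simp
  then have "integrable (lebesgue_on K) (\<lambda>x. (cmod (f x + g x))\<^sup>2)"
    by (rule Bochner_Integration.integrable_bound)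
      (use assms[THEN L2_measurable] cmod_add_squared_le in auto)
  then show ?thesis using assms[THEN L2_measurable] by (simp add: L2_def)
qed

lemma L2_mult_bounded:
  assumes "g \<in> L2 K" "f \<in> borel_measurable (lebesgue_on K)"
    and "\<And>x. x \<in> space (lebesgue_on K) \<Longrightarrow> cmod (f x) \<le> B"
  shows "(\<lambda>x. f x * g x) \<in> L2 K"
  by (rule L2_dominated[OF assms(1), where B=B])
    (use assms(2) L2_measurable[OF assms(1)] assms(3) in \<open>auto simp: norm_mult mult_right_mono\<close>)

lemma L2_cmult: "f \<in> L2 K \<Longrightarrow> (\<lambda>x. c * f x) \<in> L2 K"
  by (rule L2_mult_bounded[where B="cmod c"]) auto

lemma L2_zero: "(\<lambda>x. 0) \<in> L2 K"
  by (simp add: L2_def)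

lemma L2_diff: "f \<in> L2 K \<Longrightarrow> g \<in> L2 K \<Longrightarrow> (\<lambda>x. f x - g x) \<in> L2 K"
  using L2_add[of f K "\<lambda>x. (-1) * g x"] L2_cmult[of g K "-1"] by simp

lemma L2_sum: "(\<And>i. i \<in> I \<Longrightarrow> f i \<in> L2 K) \<Longrightarrow> (\<lambda>x. \<Sum>i\<in>I. f i x) \<in> L2 K"
  by (induction I rule: infinite_finite_induct) (auto simp: L2_zero L2_add)

lemma L2_inner_integrable:
  assumes "f \<in> L2 K" "g \<in> L2 K"
  shows "integrable (lebesgue_on K) (\<lambda>x. cnj (f x) * g x)"
proof -
  have "integrable (lebesgue_on K) (\<lambda>x. (cmod (f x))\<^sup>2 + (cmod (g x))\<^sup>2)"
    using assms[THEN L2_integrable] by simp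
  then show ?thesis
  proof (rule Bochner_Integration.integrable_bound)
    show "(\<lambda>x. cnj (f x) * g x) \<in> borel_measurable (lebesgue_on K)"
      using assms[THEN L2_measurable] by (intro borel_measurable_times borel_measurable_continuous_onI
          measurable_compose[of f _ borel cnj]) (auto intro: continuous_intros)
    have "cmod u * cmod v \<le> (cmod u)\<^sup>2 + (cmod v)\<^sup>2" for u v
      using sum_squares_bound[of "cmod u" "cmod v"] mult_nonneg_nonneg[of "cmod u" "cmod v"]
      unfolding mult.assoc using norm_ge_zero[of u] norm_ge_zero[of v] by linarith
    then show "AE x in lebesgue_on K. norm (cnj (f x) * g x) \<le> norm ((cmod (f x))\<^sup>2 + (cmod (g x))\<^sup>2)"
      by (auto simp: norm_mult)
  qed
qed

lemma L2_inner_add_right: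
  "f \<in> L2 K \<Longrightarrow> g \<in> L2 K \<Longrightarrow> h \<in> L2 K \<Longrightarrow>
    L2_inner K f (\<lambda>x. g x + h x) = L2_inner K f g + L2_inner K f h"
  by (simp add: L2_inner_def distrib_left L2_inner_integrable)

lemma L2_inner_diff_right:
  "f \<in> L2 K \<Longrightarrow> g \<in> L2 K \<Longrightarrow> h \<in> L2 K \<Longrightarrow>
    L2_inner K f (\<lambda>x. g x - h x) = L2_inner K f g - L2_inner K f h"
  by (simp add: L2_inner_def right_diff_distrib L2_inner_integrable)

lemma L2_inner_cmult_right: "L2_inner K f (\<lambda>x. c * g x) = c * L2_inner K f g"
  by (simp add: L2_inner_def mult.left_commute[of _ c])

lemma L2_inner_sum_right:
  "f \<in> L2 K \<Longrightarrow> (\<And>i. i \<in> I \<Longrightarrow> g i \<in> L2 K) \<Longrightarrow>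
    L2_inner K f (\<lambda>x. \<Sum>i\<in>I. g i x) = (\<Sum>i\<in>I. L2_inner K f (g i))"
  by (simp add: L2_inner_def sum_distrib_left L2_inner_integrable)

lemma cnj_L2_inner: "cnj (L2_inner K f g) = L2_inner K g f"
proof -
  have "cnj (L2_inner K f g) = (LINT x|lebesgue_on K. cnj (cnj (f x) * g x))"
    unfolding L2_inner_def
    by (rule Bochner_Integration.integral_bounded_linear'[OF bounded_linear_cnj bounded_linear_cnj, symmetric]) simp
  also have "\<dots> = L2_inner K g f"
    unfolding L2_inner_def by (simp only: complex_cnj_mult complex_cnj_cnj mult.commute)
  finally show ?thesis .
qed

lemma L2_inner_diff_left:
  "f \<in> L2 K \<Longrightarrow> g \<in> L2 K \<Longrightarrow> h \<in> L2 K \<Longrightarrow>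
    L2_inner K (\<lambda>x. g x - h x) f = L2_inner K g f - L2_inner K h f"
  by (subst (1 2 3) cnj_L2_inner[symmetric]) (simp add: L2_inner_diff_right)

lemma L2_inner_add_left:
  "f \<in> L2 K \<Longrightarrow> g \<in> L2 K \<Longrightarrow> h \<in> L2 K \<Longrightarrow>
    L2_inner K (\<lambda>x. g x + h x) f = L2_inner K g f + L2_inner K h f"
  by (subst (1 2 3) cnj_L2_inner[symmetric]) (simp add: L2_inner_add_right)

lemma L2_inner_cmult_left: "L2_inner K (\<lambda>x. c * f x) g = cnj c * L2_inner K f g"
  by (subst (1 2) cnj_L2_inner[symmetric]) (simp add: L2_inner_cmult_right)

lemma L2_inner_sum_left:
  "g \<in> L2 K \<Longrightarrow> (\<And>i. i \<in> I \<Longrightarrow> f i \<in> L2 K) \<Longrightarrow>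
    L2_inner K (\<lambda>x. \<Sum>i\<in>I. f i x) g = (\<Sum>i\<in>I. L2_inner K (f i) g)"
  using L2_inner_sum_right[of g K I f] arg_cong[where f=cnj]
  by (subst cnj_L2_inner[symmetric]) (simp add: cnj_L2_inner)

lemma L2_inner_self: "L2_inner K f f = complex_of_real (normsq K f)"
proof -
  have "L2_inner K f f = (LINT x|lebesgue_on K. complex_of_real ((cmod (f x))\<^sup>2))"
    unfolding L2_inner_def
    by (rule Bochner_Integration.integral_cong) (simp_all add: complex_norm_square mult.commute del: of_real_power)
  then show ?thesis by (simp only: normsq_def integral_complex_of_real)
qed

lemma L2_inner_cong_AE:
  assumes "AE x in lebesgue_on K. f x = f' x" "AE x in lebesgue_on K. g x = g' x"
    and "f \<in> L2 K" "f' \<in> L2 K" "g \<in> L2 K" "g' \<in> L2 K"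
  shows "L2_inner K f g = L2_inner K f' g'"
  unfolding L2_inner_def using assms
  by (intro integral_cong_AE borel_measurable_integrable L2_inner_integrable) auto

lemma normsq_add:
  assumes "f \<in> L2 K" "g \<in> L2 K"
  shows "normsq K (\<lambda>x. f x + g x) = normsq K f + normsq K g + 2 * Re (L2_inner K f g)"
proof -
  have "complex_of_real (normsq K (\<lambda>x. f x + g x))
      = L2_inner K f f + L2_inner K g g + (L2_inner K f g + cnj (L2_inner K f g))"
    using assms by (simp add: L2_inner_self[symmetric] L2_add L2_inner_add_left L2_inner_add_right cnj_L2_inner)
  then have "complex_of_real (normsq K (\<lambda>x. f x + g x))
      = complex_of_real (normsq K f + normsq K g + 2 * Re (L2_inner K f g))"
    by (simp add: L2_inner_self complex_add_cnj)
  then show ?thesis using of_real_eq_iff by blast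
qed

lemma normsq_cmult: "normsq K (\<lambda>x. c * f x) = (cmod c)\<^sup>2 * normsq K f"
  by (simp add: normsq_def norm_mult power_mult_distrib)

lemma normsq_add_le:
  assumes "f \<in> L2 K" "g \<in> L2 K"
  shows "normsq K (\<lambda>x. f x + g x) \<le> 2 * normsq K f + 2 * normsq K g"
proof -
  have "normsq K (\<lambda>x. f x + g x) \<le> (LINT x|lebesgue_on K. 2 * (cmod (f x))\<^sup>2 + 2 * (cmod (g x))\<^sup>2)"
    unfolding normsq_def using assms[THEN L2_integrable] L2_integrable[OF L2_add[OF assms]]
    by (intro integral_mono) (auto intro: cmod_add_squared_le)
  also have "\<dots> = 2 * normsq K f + 2 * normsq K g"
    using assms[THEN L2_integrable] by (simp add: normsq_def)
  finally show ?thesis .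
qed

lemma L2_Cauchy_Schwarz:
  assumes "f \<in> L2 K" "g \<in> L2 K"
  shows "(cmod (L2_inner K f g))\<^sup>2 \<le> normsq K f * normsq K g"
proof (cases "normsq K g = 0")
  case False
  define s where "s = normsq K g"
  define c where "c = cnj (L2_inner K f g)"
  have s: "s > 0" using False normsq_nonneg[of K g] by (simp add: s_def)
  (* Up to the factor s this is f minus its projection onto g, the choice that minimises the norm. *)
  have "0 \<le> normsq K (\<lambda>x. complex_of_real s * f x + (- c) * g x)" by (rule normsq_nonneg)
  also have "\<dots> = s\<^sup>2 * normsq K f + (cmod c)\<^sup>2 * s - 2 * Re (s * (c * L2_inner K f g))"
    using s assms by (subst normsq_add) (simp_all only: L2_cmult normsq_cmult L2_inner_cmult_left L2_inner_cmult_right,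
       simp_all add: s_def[symmetric] algebra_simps)
  also have "c * L2_inner K f g = complex_of_real ((cmod c)\<^sup>2)"
    by (simp add: c_def complex_norm_square mult.commute del: of_real_power)
  finally have "0 \<le> s * (s * normsq K f - (cmod c)\<^sup>2)"
    by (simp add: power2_eq_square algebra_simps)
  then have "(cmod c)\<^sup>2 \<le> s * normsq K f" using s by (simp add: zero_le_mult_iff)
  then show ?thesis by (simp add: c_def s_def mult.commute)
next
  case True
  have "AE x in lebesgue_on K. (cmod (g x))\<^sup>2 = 0"
    using True L2_integrable[OF assms(2)] integral_nonneg_eq_0_iff_AE[of "lebesgue_on K" "\<lambda>x. (cmod (g x))\<^sup>2"]
    by (simp add: normsq_def)
  then have "L2_inner K f g = L2_inner K f (\<lambda>x. 0)"
    using assms by (intro L2_inner_cong_AE) (auto simp: L2_zero)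
  then show ?thesis using True by (simp add: L2_inner_def)
qed

lemma L2_inner_tendsto_left:
  assumes "\<And>n. f n \<in> L2 K" "g \<in> L2 K" "h \<in> L2 K"
    and "(\<lambda>n. normsq K (\<lambda>x. g x - f n x)) \<longlonglongrightarrow> 0"
  shows "(\<lambda>n. L2_inner K (f n) h) \<longlonglongrightarrow> L2_inner K g h"
proof -
  have "(\<lambda>n. sqrt (normsq K (\<lambda>x. g x - f n x) * normsq K h)) \<longlonglongrightarrow> sqrt (0 * normsq K h)"
    by (intro tendsto_intros assms(4))
  then have "(\<lambda>n. sqrt (normsq K (\<lambda>x. g x - f n x) * normsq K h)) \<longlonglongrightarrow> 0" by simp
  then have "(\<lambda>n. L2_inner K (\<lambda>x. g x - f n x) h) \<longlonglongrightarrow> 0"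
    by (rule Lim_null_comparison[rotated])
      (intro always_eventually allI real_le_rsqrt L2_Cauchy_Schwarz L2_diff assms)
  then have "(\<lambda>n. L2_inner K g h - L2_inner K (f n) h) \<longlonglongrightarrow> 0"
    using assms by (simp add: L2_inner_diff_left)
  from tendsto_diff[OF tendsto_const[of "L2_inner K g h"] this] show ?thesis by simp
qed

lemma orthonormal_basis_Parseval:
  assumes basis: "orthonormal_basis K \<phi>" and f: "f \<in> L2 K" and h: "h \<in> L2 K"
  shows "(\<lambda>n. \<Sum>k=1..n. cnj (L2_inner K (\<phi> k) f) * L2_inner K (\<phi> k) h) \<longlonglongrightarrow> L2_inner K f h"
proof -
  define S where "S n = (\<lambda>x. \<Sum>k=1..n. L2_inner K (\<phi> k) f * \<phi> k x)" for n
  have phi: "\<And>k. k \<ge> 1 \<Longrightarrow> \<phi> k \<in> L2 K" using basis by (simp add: orthonormal_basis_def)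
  have S: "S n \<in> L2 K" for n unfolding S_def by (intro L2_sum L2_cmult phi) auto
  have "(\<lambda>n. L2_norm K (\<lambda>x. f x - S n x)) \<longlonglongrightarrow> 0"
    using basis f by (simp add: orthonormal_basis_def S_def)
  then have "(\<lambda>n. (L2_norm K (\<lambda>x. f x - S n x))\<^sup>2) \<longlonglongrightarrow> 0\<^sup>2"
    by (rule tendsto_power)
  then have "(\<lambda>n. normsq K (\<lambda>x. f x - S n x)) \<longlonglongrightarrow> 0"
    by (simp add: L2_norm_def normsq_def)
  from L2_inner_tendsto_left[OF S f h this]
  have "(\<lambda>n. L2_inner K (S n) h) \<longlonglongrightarrow> L2_inner K f h" .
  moreover have "L2_inner K (S n) h = (\<Sum>k=1..n. cnj (L2_inner K (\<phi> k) f) * L2_inner K (\<phi> k) h)" for n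
    unfolding S_def using h phi by (subst L2_inner_sum_left) (auto simp: L2_cmult L2_inner_cmult_left)
  ultimately show ?thesis by simp
qed

section \<open>Plane waves and weak derivatives\<close>

definition wave :: "real ^ 'n \<Rightarrow> real ^ 'n \<Rightarrow> complex" where
  "wave \<xi> x = cis (\<xi> \<bullet> x)"

text \<open>The frequencies \<open>\<xi>\<close> collected here are those for which the plane wave
  \<open>exp (i \<xi> \<bullet> x)\<close> has the periods \<open>2 \<pi> / q\<^sub>i\<close>. They form a group, and multiplication by a
  plane wave translates Fourier coefficients along it; this is what makes plane waves usable as
  the auxiliary operators \<open>G\<close>.\<close>

definition dual_lattice :: "real ^ 'n \<Rightarrow> (real ^ 'n) set" where
  "dual_lattice q = {\<xi>. \<forall>i. \<exists>n::int. \<xi> $ i = of_int n * q $ i}"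

lemma wave_zero: "wave 0 x = 1"
  and wave_mult: "wave \<xi> x * wave \<eta> x = wave (\<xi> + \<eta>) x"
  and cnj_wave: "cnj (wave \<xi> x) = wave (- \<xi>) x"
  and norm_wave: "cmod (wave \<xi> x) = 1"
  by (simp_all add: wave_def cis_mult inner_add_left cis_cnj)

lemma wave_measurable: "wave \<xi> \<in> borel_measurable (lebesgue_on K)"
proof -
  have "continuous_on UNIV (wave \<xi>)" unfolding wave_def by (intro continuous_intros)
  then have "wave \<xi> \<in> borel_measurable lebesgue"
    by (simp add: borel_measurable_continuous_onI measurable_completion)
  then show ?thesis by (rule measurable_restrict_space1)
qed

lemma L2_wave_mult: "f \<in> L2 K \<Longrightarrow> (\<lambda>x. wave \<xi> x * f x) \<in> L2 K"
  by (rule L2_mult_bounded[where B=1]) (auto simp: wave_measurable norm_wave)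

lemma dual_lattice_zero: "0 \<in> dual_lattice q"
  unfolding dual_lattice_def by (auto intro: exI[of _ 0])

lemma dual_lattice_add: "\<xi> \<in> dual_lattice q \<Longrightarrow> \<eta> \<in> dual_lattice q \<Longrightarrow> \<xi> + \<eta> \<in> dual_lattice q"
  unfolding dual_lattice_def mem_Collect_eq vector_add_component
  by (metis distrib_right of_int_add)

lemma dual_lattice_uminus: "\<xi> \<in> dual_lattice q \<Longrightarrow> - \<xi> \<in> dual_lattice q"
  unfolding dual_lattice_def mem_Collect_eq vector_uminus_component
  by (metis minus_mult_left of_int_minus)

lemma dual_lattice_diff: "\<xi> \<in> dual_lattice q \<Longrightarrow> \<eta> \<in> dual_lattice q \<Longrightarrow> \<xi> - \<eta> \<in> dual_lattice q"
  using dual_lattice_add[of \<xi> q "- \<eta>"] dual_lattice_uminus[of \<eta> q] by simp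

lemma dual_lattice_axis: "axis l (q $ l) \<in> dual_lattice q"
proof -
  have "axis l (q $ l) $ i = of_int (if i = l then 1 else 0) * q $ i" for i
    by (simp add: axis_def)
  then show ?thesis unfolding dual_lattice_def by blast
qed

lemma L2_inner_wave_wave_mult:
  "L2_inner K (wave \<xi>) (\<lambda>x. wave \<eta> x * f x) = L2_inner K (wave (\<xi> - \<eta>)) f"
proof -
  have *: "cnj (wave \<xi> x) * (wave \<eta> x * f x) = cnj (wave (\<xi> - \<eta>) x) * f x" for x
    by (simp add: cnj_wave wave_mult mult.assoc[symmetric])
  show ?thesis unfolding L2_inner_def * ..
qed

lemma L2_inner_wave_mult_both: "L2_inner K (\<lambda>x. wave \<xi> x * f x) (\<lambda>x. wave \<xi> x * g x) = L2_inner K f g"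
proof -
  have "cnj (wave \<xi> x * f x) * (wave \<xi> x * g x) = (wave (-\<xi>) x * wave \<xi> x) * (cnj (f x) * g x)" for x
    by (simp add: cnj_wave)
  then have *: "cnj (wave \<xi> x * f x) * (wave \<xi> x * g x) = cnj (f x) * g x" for x
    by (simp add: wave_mult wave_zero)
  show ?thesis unfolding L2_inner_def * ..
qed

lemma wave_has_derivative:
  "((\<lambda>x. c * wave \<xi> x) has_derivative (\<lambda>h. c * (\<i> * of_real (\<xi> \<bullet> h) * wave \<xi> x))) (at x)"
proof -
  have "bounded_linear (\<lambda>h. \<i> * complex_of_real (\<xi> \<bullet> h))"
    by (intro bounded_linear_const_mult bounded_linear_compose[OF bounded_linear_of_real] bounded_linear_inner_right)
  from has_derivative_compose[OF bounded_linear_imp_has_derivative[OF this]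
      DERIV_exp[unfolded has_field_derivative_def]]
  have *: "((\<lambda>x. exp (\<i> * of_real (\<xi> \<bullet> x))) has_derivative
      (\<lambda>h. exp (\<i> * of_real (\<xi> \<bullet> x)) * (\<i> * of_real (\<xi> \<bullet> h)))) (at x)" .
  from has_derivative_mult_right[OF *, of c] show ?thesis
    by (simp add: wave_def cis_conv_exp mult_ac)
qed

lemma partial_deriv_wave:
  "partial_deriv i (\<lambda>x. c * wave \<xi> x) = (\<lambda>x. (c * \<i> * of_real (\<xi> $ i)) * wave \<xi> x)"
  unfolding partial_deriv_def frechet_derivative_at[OF wave_has_derivative, symmetric]
  by (simp add: inner_axis mult_ac)

lemma smooth_wave: "smooth (\<lambda>x. c * wave \<xi> x)"
proof -
  have "C_k k (\<lambda>x. c * wave \<xi> x)" for k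
  proof (induction k arbitrary: c)
    case 0
    show ?case by (auto simp: wave_def intro!: continuous_intros)
  next
    case (Suc k)
    have "(\<lambda>x. c * wave \<xi> x) differentiable_on UNIV"
      unfolding differentiable_on_def differentiable_def using wave_has_derivative by blast
    then show ?case using Suc by (simp add: partial_deriv_wave)
  qed
  then show ?thesis by (simp add: smooth_def)
qed

lemma periodic_wave:
  assumes "\<And>i. q $ i > 0" "\<xi> \<in> dual_lattice q"
  shows "periodic q (wave \<xi>)"
  unfolding periodic_def
proof (intro allI)
  fix x i
  obtain n :: int where n: "\<xi> $ i = of_int n * q $ i"
    using assms(2) by (auto simp: dual_lattice_def)
  have "\<xi> \<bullet> axis i (2 * pi / q $ i) = 2 * pi * of_int n"
    using assms(1)[of i] by (simp add: inner_axis n field_simps)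
  then show "wave \<xi> (x + axis i (2 * pi / q $ i)) = wave \<xi> x"
    by (simp add: wave_def inner_add_right cis_multiple_2pi flip: cis_mult)
qed

text \<open>Conjugate plane waves are admissible test functions, so a weak derivative is visible on
  Fourier coefficients. This is the form in which weak derivatives enter all later integrations
  by parts.\<close>

lemma weak_partial_deriv_coeff:
  assumes "\<And>i. q $ i > 0" "\<xi> \<in> dual_lattice q" "weak_partial_deriv K q i u v"
  shows "L2_inner K (wave \<xi>) v = \<i> * of_real (\<xi> $ i) * L2_inner K (wave \<xi>) u"
proof -
  let ?\<psi> = "\<lambda>x. 1 * wave (- \<xi>) x"
  have "smooth ?\<psi> \<and> periodic q ?\<psi>"
    using smooth_wave[of 1 "-\<xi>"] periodic_wave[OF assms(1) dual_lattice_uminus[OF assms(2)]] by simp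
  then have "(LINT x|lebesgue_on K. u x * partial_deriv i ?\<psi> x) = - (LINT x|lebesgue_on K. v x * ?\<psi> x)"
    using assms(3) unfolding weak_partial_deriv_def by blast
  then have "(LINT x|lebesgue_on K. (- \<i> * of_real (\<xi> $ i)) * (wave (- \<xi>) x * u x))
      = - (LINT x|lebesgue_on K. wave (- \<xi>) x * v x)"
    unfolding partial_deriv_wave by (simp add: mult_ac)
  then show ?thesis
    by (simp add: L2_inner_def cnj_wave mult.assoc)
qed

section \<open>Orthogonality of the plane waves\<close>

text \<open>Lebesgue measure is the product of its one-dimensional copies, so the orthogonality relations
  factor into integrals over single periods.\<close>

lemma integral_lborel_prod_Basis:
  fixes f :: "'a::euclidean_space \<Rightarrow> real \<Rightarrow> complex"
  assumes "\<And>b. b \<in> Basis \<Longrightarrow> integrable lborel (f b)"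
  shows "(LINT x|lborel. (\<Prod>b\<in>Basis. f b (x \<bullet> b))) = (\<Prod>b\<in>Basis. (LINT t|lborel. f b t))"
proof -
  interpret product_sigma_finite "\<lambda>_::'a. lborel :: real measure" ..
  have [measurable]: "\<And>b. b \<in> Basis \<Longrightarrow> f b \<in> borel_measurable borel"
    using borel_measurable_integrable[OF assms] by simp
  have "(LINT x|lborel. (\<Prod>b\<in>Basis. f b (x \<bullet> b)))
      = (LINT y|(\<Pi>\<^sub>M b\<in>Basis. lborel). (\<Prod>b\<in>Basis. f b ((\<Sum>c\<in>Basis. y c *\<^sub>R c) \<bullet> b)))"
    by (subst lborel_eq) (simp add: integral_distr)
  also have "\<dots> = (LINT y|(\<Pi>\<^sub>M b\<in>Basis. lborel). (\<Prod>b\<in>Basis. f b (y b)))"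
    by simp
  also have "\<dots> = (\<Prod>b\<in>Basis. (LINT t|lborel. f b t))"
    by (rule product_integral_prod) (use assms in auto)
  finally show ?thesis .
qed

lemma integral_cis_period:
  fixes n :: int
  assumes "n \<noteq> 0" "p > 0" "\<beta> - \<alpha> = 2 * pi / p"
  shows "(LINT t|lborel. indicator {\<alpha>..\<beta>} t *\<^sub>R cis (of_int n * p * t)) = 0"
proof -
  define c where "c = of_int n * p"
  have c: "c \<noteq> 0" using assms by (simp add: c_def)
  have "\<alpha> \<le> \<beta>" using assms(2,3) by (smt (verit) pi_gt_zero divide_pos_pos)
  have "(LINT t|lborel. indicator {\<alpha>..\<beta>} t *\<^sub>R cis (c * t))
      = cis (c * \<beta>) / (\<i> * c) - cis (c * \<alpha>) / (\<i> * c)"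
  proof (rule integral_FTC_Icc[OF \<open>\<alpha> \<le> \<beta>\<close>])
    show "continuous_on {\<alpha>..\<beta>} (\<lambda>t. cis (c * t))" by (intro continuous_intros)
    fix t
    have "((\<lambda>z. exp (\<i> * c * z) / (\<i> * c)) has_field_derivative exp (\<i> * c * of_real t)) (at (of_real t))"
      using c by (auto intro!: derivative_eq_intros)
    from has_vector_derivative_real_field[OF this] show "((\<lambda>t. cis (c * t) / (\<i> * c)) has_vector_derivative cis (c * t)) (at t within {\<alpha>..\<beta>})"
      by (simp add: cis_conv_exp mult.assoc)
  qed
  also have "c * \<beta> = c * \<alpha> + 2 * pi * of_int n"
  proof -
    have "c * \<beta> - c * \<alpha> = of_int n * (p * (\<beta> - \<alpha>))"
      by (simp add: c_def algebra_simps)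
    also have "\<dots> = of_int n * (p * (2 * pi / p))" by (simp only: assms(3))
    finally have "c * \<beta> - c * \<alpha> = of_int n * (p * (2 * pi / p))" .
    then show ?thesis using assms(2) by (simp add: algebra_simps)
  qed
  finally show ?thesis by (simp add: c_def cis_multiple_2pi flip: cis_mult)
qed

lemma integral_wave_eq_0:
  fixes q a b :: "real ^ 'n"
  assumes "\<And>i. q $ i > 0" "\<And>i. b $ i - a $ i = 2 * pi / q $ i" "\<xi> \<in> dual_lattice q" "\<xi> \<noteq> 0"
  shows "(LINT x|lebesgue_on (cbox a b). wave \<xi> x) = 0"
proof -
  obtain l where l: "\<xi> $ l \<noteq> 0" using assms(4) by (auto simp: vec_eq_iff)
  obtain n :: int where n: "\<xi> $ l = of_int n * q $ l" using assms(3) by (auto simp: dual_lattice_def)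
  define f where "f e t = indicator {a \<bullet> e..b \<bullet> e} t *\<^sub>R cis (\<xi> \<bullet> e * t)" for e t
  have "(LINT x|lebesgue_on (cbox a b). wave \<xi> x) = (LINT x|lebesgue. indicator (cbox a b) x *\<^sub>R wave \<xi> x)"
    by (subst integral_restrict_space) auto
  also have "\<dots> = (LINT x|lborel. indicator (cbox a b) x *\<^sub>R wave \<xi> x)"
    by (intro integral_completion borel_measurable_scaleR borel_measurable_indicator)
      (auto simp: wave_def intro!: borel_measurable_continuous_onI continuous_intros)
  also have "\<dots> = (LINT x|lborel. (\<Prod>e\<in>Basis. f e (x \<bullet> e)))"
  proof (rule Bochner_Integration.integral_cong[OF refl])
    fix x :: "real ^ 'n"
    have 1: "indicator (cbox a b) x = (\<Prod>e\<in>Basis. indicator {a \<bullet> e..b \<bullet> e} (x \<bullet> e) :: real)"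
    proof (cases "x \<in> cbox a b")
      case False
      then obtain e where "e \<in> Basis" "x \<bullet> e \<notin> {a \<bullet> e..b \<bullet> e}" by (auto simp: mem_box)
      then show ?thesis using False by (auto intro!: prod_zero[symmetric] bexI[of _ e])
    qed (auto simp: mem_box)
    have "\<i> * of_real (\<xi> \<bullet> x) = (\<Sum>e\<in>Basis. \<i> * of_real (\<xi> \<bullet> e * (x \<bullet> e)))"
      by (subst euclidean_inner) (simp add: sum_distrib_left)
    then have 2: "wave \<xi> x = (\<Prod>e\<in>Basis. cis (\<xi> \<bullet> e * (x \<bullet> e)))"
      by (simp add: wave_def cis_conv_exp exp_sum)
    show "indicator (cbox a b) x *\<^sub>R wave \<xi> x = (\<Prod>e\<in>Basis. f e (x \<bullet> e))"
      unfolding 1 2 f_def by (simp add: scaleR_conv_of_real prod.distrib)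
  qed
  also have "\<dots> = (\<Prod>e\<in>Basis. (LINT t|lborel. f e t))"
  proof (rule integral_lborel_prod_Basis)
    fix e
    have "continuous_on {a \<bullet> e..b \<bullet> e} (\<lambda>t. cis (\<xi> \<bullet> e * t))"
      by (intro continuous_intros)
    from borel_integrable_compact[OF compact_Icc this] show "integrable lborel (f e)"
      unfolding f_def .
  qed
  also have "\<dots> = 0"
  proof -
    have "axis l 1 \<in> (Basis :: (real ^ 'n) set)" by simp
    moreover have "(LINT t|lborel. f (axis l 1) t) = 0"
      using integral_cis_period[of n "q $ l" "b $ l" "a $ l"] l n assms(1,2)
      by (simp add: f_def inner_axis)
    ultimately show ?thesis by (meson finite_Basis prod_zero)
  qed
  finally show ?thesis .
qed

section \<open>Completeness of the plane waves\<close>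

text \<open>The aim is that finite combinations of plane waves are dense in \<open>L\<^sup>2(K)\<close>. The closure of the
  trigonometric polynomials is stable under multiplication by plane waves, hence the product of one
  of its bounded elements with another element stays in it. So its bounded elements form an algebra
  closed under bounded pointwise limits, and the sets with indicator in the closure form a
  \<open>\<sigma>\<close>-algebra. It suffices to find the half-spaces in it, and these are described, up to a
  null set, by inequalities for the functions \<open>cos\<close> and \<open>sin\<close> of one normalised coordinate.\<close>

locale torus_box =
  fixes q a b :: "real ^ 'n" and K :: "(real ^ 'n) set"
  assumes q_pos: "\<And>i. q $ i > 0"
    and K_box: "K = cbox a b"
    and sides: "\<And>i. b $ i - a $ i = 2 * pi / q $ i"
begin

lemma space_K [simp]: "space (lebesgue_on K) = K"
  by (simp add: K_box)

lemma K_measurable: "K \<in> lmeasurable"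
  by (simp add: K_box)

lemma finite_measure_K: "finite_measure (lebesgue_on K)"
  by (rule finite_measure_lebesgue_on[OF K_measurable])

lemma L2_const: "(\<lambda>x. c) \<in> L2 K"
proof -
  interpret finite_measure "lebesgue_on K" by (rule finite_measure_K)
  show ?thesis by (simp add: L2_def)
qed

lemma L2_bounded:
  assumes "f \<in> borel_measurable (lebesgue_on K)" "\<And>x. x \<in> K \<Longrightarrow> cmod (f x) \<le> B"
  shows "f \<in> L2 K"
  by (rule L2_dominated[OF L2_const[of 1] assms(1), where B=B]) (use assms(2) in auto)

lemma L2_wave: "wave \<xi> \<in> L2 K"
  by (rule L2_bounded[OF wave_measurable, where B=1]) (simp add: norm_wave)

lemma normsq_cong_AE:
  assumes "AE x in lebesgue_on K. f x = g x" "f \<in> L2 K" "g \<in> L2 K"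
  shows "normsq K f = normsq K g"
  unfolding normsq_def using assms
  by (intro integral_cong_AE borel_measurable_integrable L2_integrable) auto

lemma normsq_mono:
  assumes "\<And>x. x \<in> K \<Longrightarrow> cmod (f x) \<le> B * cmod (g x)" "f \<in> L2 K" "g \<in> L2 K"
  shows "normsq K f \<le> B\<^sup>2 * normsq K g"
proof -
  have "normsq K f \<le> (LINT x|lebesgue_on K. B\<^sup>2 * (cmod (g x))\<^sup>2)"
    unfolding normsq_def
  proof (rule integral_mono)
    fix x assume "x \<in> space (lebesgue_on K)"
    then show "(cmod (f x))\<^sup>2 \<le> B\<^sup>2 * (cmod (g x))\<^sup>2"
      using power_mono[OF assms(1), of x 2] by (simp add: power_mult_distrib)
  qed (use L2_integrable[OF assms(2)] L2_integrable[OF assms(3)] in auto)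
  then show ?thesis by (simp add: normsq_def)
qed

definition trig :: "(real ^ 'n \<Rightarrow> complex) set" where
  "trig = {p. \<exists>F c. finite F \<and> F \<subseteq> dual_lattice q \<and> p = (\<lambda>x. \<Sum>\<xi>\<in>F. c \<xi> * wave \<xi> x)}"

lemma trig_L2: "p \<in> trig \<Longrightarrow> p \<in> L2 K"
  unfolding trig_def by (auto intro!: L2_sum L2_cmult L2_wave)

lemma trig_cmult_wave:
  assumes "\<xi> \<in> dual_lattice q"
  shows "(\<lambda>x. c * wave \<xi> x) \<in> trig"
  unfolding trig_def using assms by (auto intro!: exI[of _ "{\<xi>}"] exI[of _ "\<lambda>_. c"])

lemma trig_add:
  assumes "p \<in> trig" "r \<in> trig"
  shows "(\<lambda>x. p x + r x) \<in> trig"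
proof -
  obtain F c where F: "finite F" "F \<subseteq> dual_lattice q" "p = (\<lambda>x. \<Sum>\<xi>\<in>F. c \<xi> * wave \<xi> x)"
    using assms(1) by (auto simp: trig_def)
  obtain G d where G: "finite G" "G \<subseteq> dual_lattice q" "r = (\<lambda>x. \<Sum>\<xi>\<in>G. d \<xi> * wave \<xi> x)"
    using assms(2) by (auto simp: trig_def)
  define e where "e \<xi> = (if \<xi> \<in> F then c \<xi> else 0) + (if \<xi> \<in> G then d \<xi> else 0)" for \<xi>
  have "p x + r x = (\<Sum>\<xi>\<in>F \<union> G. e \<xi> * wave \<xi> x)" for x
  proof -
    have "p x = (\<Sum>\<xi>\<in>F \<union> G. (if \<xi> \<in> F then c \<xi> else 0) * wave \<xi> x)"
      unfolding F(3) using F(1) G(1) by (intro sum.mono_neutral_cong_left) auto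
    moreover have "r x = (\<Sum>\<xi>\<in>F \<union> G. (if \<xi> \<in> G then d \<xi> else 0) * wave \<xi> x)"
      unfolding G(3) using F(1) G(1) by (intro sum.mono_neutral_cong_left) auto
    ultimately show ?thesis by (simp add: e_def distrib_right sum.distrib)
  qed
  then show ?thesis unfolding trig_def using F(1,2) G(1,2)
    by (auto intro!: exI[of _ "F \<union> G"] exI[of _ e])
qed

lemma trig_sum: "finite I \<Longrightarrow> (\<And>i. i \<in> I \<Longrightarrow> p i \<in> trig) \<Longrightarrow> (\<lambda>x. \<Sum>i\<in>I. p i x) \<in> trig"
proof (induction I rule: finite_induct)
  case empty
  show ?case using trig_cmult_wave[OF dual_lattice_zero, of 0] by simp
qed (auto intro: trig_add)

lemma trig_wave_mult:
  assumes "p \<in> trig" "\<eta> \<in> dual_lattice q"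
  shows "(\<lambda>x. c * wave \<eta> x * p x) \<in> trig"
proof -
  obtain F d where F: "finite F" "F \<subseteq> dual_lattice q" "p = (\<lambda>x. \<Sum>\<xi>\<in>F. d \<xi> * wave \<xi> x)"
    using assms(1) by (auto simp: trig_def)
  have "c * wave \<eta> x * p x = (\<Sum>\<xi>\<in>F. (c * d \<xi>) * wave (\<eta> + \<xi>) x)" for x
    by (simp add: F(3) sum_distrib_left flip: wave_mult) (simp add: mult_ac)
  then show ?thesis
    using F assms(2) by (auto intro!: trig_sum trig_cmult_wave dual_lattice_add)
qed

definition approximable :: "(real ^ 'n \<Rightarrow> complex) \<Rightarrow> bool" where
  "approximable f \<longleftrightarrow> f \<in> L2 K \<and> (\<forall>\<epsilon>>0. \<exists>p\<in>trig. normsq K (\<lambda>x. f x - p x) < \<epsilon>)"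

lemma approximable_L2: "approximable f \<Longrightarrow> f \<in> L2 K"
  by (simp add: approximable_def)

lemma approximable_trig: "p \<in> trig \<Longrightarrow> approximable p"
  unfolding approximable_def by (auto simp: trig_L2 normsq_def intro!: bexI[of _ p])

lemma approximable_limit:
  assumes "f \<in> L2 K" "\<And>\<epsilon>. \<epsilon> > 0 \<Longrightarrow> \<exists>g. approximable g \<and> normsq K (\<lambda>x. f x - g x) < \<epsilon>"
  shows "approximable f"
  unfolding approximable_def
proof (intro conjI allI impI)
  fix \<epsilon> :: real assume "\<epsilon> > 0"
  then obtain g where g: "approximable g" "normsq K (\<lambda>x. f x - g x) < \<epsilon> / 4"
    using assms(2)[of "\<epsilon> / 4"] by auto
  then obtain p where p: "p \<in> trig" "normsq K (\<lambda>x. g x - p x) < \<epsilon> / 4"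
    using \<open>\<epsilon> > 0\<close> unfolding approximable_def by (metis zero_less_divide_iff zero_less_numeral)
  have "normsq K (\<lambda>x. (f x - g x) + (g x - p x)) \<le> 2 * normsq K (\<lambda>x. f x - g x) + 2 * normsq K (\<lambda>x. g x - p x)"
    using assms(1) g(1) p(1) by (intro normsq_add_le L2_diff) (auto simp: approximable_L2 trig_L2)
  then have "normsq K (\<lambda>x. f x - p x) < \<epsilon>" using g(2) p(2) by simp
  then show "\<exists>p\<in>trig. normsq K (\<lambda>x. f x - p x) < \<epsilon>" using p(1) by blast
qed (rule assms(1))

lemma approximable_cong_AE:
  assumes "approximable f" "AE x in lebesgue_on K. f x = g x" "g \<in> L2 K"
  shows "approximable g"
proof (rule approximable_limit[OF assms(3)])
  fix \<epsilon> :: real assume "\<epsilon> > 0"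
  have "normsq K (\<lambda>x. g x - f x) = normsq K (\<lambda>x. 0)"
    using assms by (intro normsq_cong_AE L2_diff) (auto simp: approximable_L2 L2_const)
  with \<open>\<epsilon> > 0\<close> assms(1) show "\<exists>h. approximable h \<and> normsq K (\<lambda>x. g x - h x) < \<epsilon>"
    by (auto simp: normsq_def)
qed

lemma approximable_cong:
  assumes "approximable f" "\<And>x. x \<in> K \<Longrightarrow> f x = g x"
  shows "approximable g"
proof (rule approximable_cong_AE[OF assms(1)])
  have "g \<in> borel_measurable (lebesgue_on K)"
    using L2_measurable[OF approximable_L2[OF assms(1)]] assms(2)
    by (subst measurable_cong[where g=f]) auto
  then show "g \<in> L2 K"
    by (rule L2_dominated[OF approximable_L2[OF assms(1)], where B=1]) (simp add: assms(2))
qed (auto simp: assms(2))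

lemma approximable_add:
  assumes "approximable f" "approximable g"
  shows "approximable (\<lambda>x. f x + g x)"
  unfolding approximable_def
proof (intro conjI allI impI)
  show "(\<lambda>x. f x + g x) \<in> L2 K" using assms by (simp add: L2_add approximable_L2)
  fix \<epsilon> :: real assume "\<epsilon> > 0"
  then obtain p r where p: "p \<in> trig" "normsq K (\<lambda>x. f x - p x) < \<epsilon> / 4"
    and r: "r \<in> trig" "normsq K (\<lambda>x. g x - r x) < \<epsilon> / 4"
    using assms unfolding approximable_def by (metis zero_less_divide_iff zero_less_numeral)
  have "normsq K (\<lambda>x. (f x - p x) + (g x - r x)) \<le> 2 * normsq K (\<lambda>x. f x - p x) + 2 * normsq K (\<lambda>x. g x - r x)"
    using assms p(1) r(1) by (intro normsq_add_le L2_diff) (auto simp: approximable_L2 trig_L2)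
  then have "normsq K (\<lambda>x. (f x + g x) - (p x + r x)) < \<epsilon>" using p(2) r(2) by (simp add: algebra_simps)
  then show "\<exists>p\<in>trig. normsq K (\<lambda>x. (f x + g x) - p x) < \<epsilon>" by (rule bexI[OF _ trig_add[OF p(1) r(1)]])
qed

lemma approximable_wave_mult:
  assumes "approximable f" "\<xi> \<in> dual_lattice q"
  shows "approximable (\<lambda>x. c * wave \<xi> x * f x)"
  unfolding approximable_def
proof (intro conjI allI impI)
  show "(\<lambda>x. c * wave \<xi> x * f x) \<in> L2 K"
    using L2_cmult[OF L2_wave_mult[OF approximable_L2[OF assms(1)]], of c \<xi>] by (simp add: mult.assoc)
  fix \<epsilon> :: real assume "\<epsilon> > 0"
  moreover have "(cmod c)\<^sup>2 + 1 > 0" by (rule add_nonneg_pos) auto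
  ultimately obtain p where p: "p \<in> trig" "normsq K (\<lambda>x. f x - p x) < \<epsilon> / ((cmod c)\<^sup>2 + 1)"
    using assms(1) unfolding approximable_def by (metis zero_less_divide_iff)
  have "normsq K (\<lambda>x. c * wave \<xi> x * f x - c * wave \<xi> x * p x) = normsq K (\<lambda>x. c * (f x - p x))"
    by (simp add: normsq_def right_diff_distrib[symmetric] norm_mult norm_wave)
  also have "\<dots> \<le> ((cmod c)\<^sup>2 + 1) * normsq K (\<lambda>x. f x - p x)"
    by (simp add: normsq_cmult distrib_right normsq_nonneg)
  also have "\<dots> < \<epsilon>" using p(2) \<open>(cmod c)\<^sup>2 + 1 > 0\<close> by (simp add: pos_less_divide_eq mult.commute)
  finally show "\<exists>r\<in>trig. normsq K (\<lambda>x. c * wave \<xi> x * f x - r x) < \<epsilon>"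
    by (rule bexI[OF _ trig_wave_mult[OF p(1) assms(2)]])
qed

lemma approximable_cmult: "approximable f \<Longrightarrow> approximable (\<lambda>x. c * f x)"
  using approximable_wave_mult[OF _ dual_lattice_zero, of f c] by (simp add: wave_zero)

lemma approximable_const: "approximable (\<lambda>x. c)"
  using approximable_trig[OF trig_cmult_wave[OF dual_lattice_zero, of c]] by (simp add: wave_zero)

lemma approximable_diff: "approximable f \<Longrightarrow> approximable g \<Longrightarrow> approximable (\<lambda>x. f x - g x)"
  using approximable_add[of f "\<lambda>x. (-1) * g x"] approximable_cmult[of g "-1"] by simp

lemma approximable_sum:
  "(\<And>i. i \<in> I \<Longrightarrow> approximable (f i)) \<Longrightarrow> approximable (\<lambda>x. \<Sum>i\<in>I. f i x)"
  by (induction I rule: infinite_finite_induct) (auto simp: approximable_const intro: approximable_add)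

text \<open>For a trigonometric polynomial \<open>p\<close> the product \<open>f p\<close> is approximable, because multiplication by
  a plane wave is isometric and preserves trigonometric polynomials; boundedness of \<open>f\<close> makes
  \<open>f p\<close> close to \<open>f g\<close> when \<open>p\<close> is close to \<open>g\<close>.\<close>

lemma approximable_mult:
  assumes f: "approximable f" "\<And>x. x \<in> K \<Longrightarrow> cmod (f x) \<le> B" and g: "approximable g"
  shows "approximable (\<lambda>x. f x * g x)"
proof (rule approximable_limit)
  have fL: "f \<in> borel_measurable (lebesgue_on K)" using f(1) by (simp add: approximable_L2 L2_measurable)
  have mult: "h \<in> L2 K \<Longrightarrow> (\<lambda>x. f x * h x) \<in> L2 K" for h
    using f(2) by (intro L2_mult_bounded[OF _ fL, of _ B]) auto
  show "(\<lambda>x. f x * g x) \<in> L2 K" using mult g by (simp add: approximable_L2)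
  fix \<epsilon> :: real assume "\<epsilon> > 0"
  moreover have "B\<^sup>2 + 1 > 0" by (rule add_nonneg_pos) auto
  ultimately obtain p where p: "p \<in> trig" "normsq K (\<lambda>x. g x - p x) < \<epsilon> / (B\<^sup>2 + 1)"
    using g unfolding approximable_def by (metis zero_less_divide_iff)
  obtain F c where F: "finite F" "F \<subseteq> dual_lattice q" "p = (\<lambda>x. \<Sum>\<xi>\<in>F. c \<xi> * wave \<xi> x)"
    using p(1) by (auto simp: trig_def)
  have "f x * p x = (\<Sum>\<xi>\<in>F. c \<xi> * wave \<xi> x * f x)" for x
    by (simp add: F(3) sum_distrib_left mult_ac)
  then have "approximable (\<lambda>x. f x * p x)"
    using F(2) f(1) by (auto intro!: approximable_sum approximable_wave_mult)
  moreover have "normsq K (\<lambda>x. f x * g x - f x * p x) \<le> B\<^sup>2 * normsq K (\<lambda>x. g x - p x)"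
    using f(2) mult[OF L2_diff[OF approximable_L2[OF g] trig_L2[OF p(1)]]] L2_diff[OF approximable_L2[OF g] trig_L2[OF p(1)]]
    by (intro normsq_mono) (auto simp: right_diff_distrib[symmetric] norm_mult mult_right_mono)
  moreover have "\<dots> \<le> (B\<^sup>2 + 1) * normsq K (\<lambda>x. g x - p x)" by (simp add: distrib_right normsq_nonneg)
  moreover have "\<dots> < \<epsilon>" using p(2) \<open>B\<^sup>2 + 1 > 0\<close> by (simp add: pos_less_divide_eq mult.commute)
  ultimately show "\<exists>h. approximable h \<and> normsq K (\<lambda>x. f x * g x - h x) < \<epsilon>"
    by (intro exI[of _ "\<lambda>x. f x * p x"]) linarith
qed

lemma approximable_dominated:
  assumes s: "\<And>i. approximable (s i)" and h: "h \<in> L2 K" and f: "f \<in> L2 K"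
    and bound: "\<And>i x. x \<in> K \<Longrightarrow> cmod (f x - s i x) \<le> cmod (h x)"
    and lim: "\<And>x. x \<in> K \<Longrightarrow> (\<lambda>i. s i x) \<longlonglongrightarrow> f x"
  shows "approximable f"
proof (rule approximable_limit[OF f])
  have "(\<lambda>i. normsq K (\<lambda>x. f x - s i x)) \<longlonglongrightarrow> (LINT x|lebesgue_on K. 0)"
    unfolding normsq_def
  proof (rule integral_dominated_convergence[where w="\<lambda>x. (cmod (h x))\<^sup>2"])
    show "(\<lambda>x. (cmod (f x - s i x))\<^sup>2) \<in> borel_measurable (lebesgue_on K)" for i
      using L2_diff[OF f approximable_L2[OF s]] by (intro borel_measurable_integrable L2_integrable)
    show "AE x in lebesgue_on K. norm ((cmod (f x - s i x))\<^sup>2) \<le> (cmod (h x))\<^sup>2" for i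
      using bound by (intro AE_I2) (auto intro!: power_mono)
    show "AE x in lebesgue_on K. (\<lambda>i. (cmod (f x - s i x))\<^sup>2) \<longlonglongrightarrow> 0"
    proof (rule AE_I2)
      fix x assume "x \<in> space (lebesgue_on K)"
      then have "(\<lambda>i. (cmod (f x - s i x))\<^sup>2) \<longlonglongrightarrow> (cmod (f x - f x))\<^sup>2"
        using lim by (intro tendsto_intros) auto
      then show "(\<lambda>i. (cmod (f x - s i x))\<^sup>2) \<longlonglongrightarrow> 0" by simp
    qed
  qed (use L2_integrable[OF h] in auto)
  then have *: "(\<lambda>i. normsq K (\<lambda>x. f x - s i x)) \<longlonglongrightarrow> 0" by simp
  fix \<epsilon> :: real assume "\<epsilon> > 0"
  then obtain i where "normsq K (\<lambda>x. f x - s i x) < \<epsilon>"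
    using eventually_happens[OF order_tendstoD(2)[OF * \<open>\<epsilon> > 0\<close>]] by auto
  then show "\<exists>g. approximable g \<and> normsq K (\<lambda>x. f x - g x) < \<epsilon>" using s by blast
qed

lemma approximable_bounded_limit:
  assumes s: "\<And>i. approximable (s i)"
    and bound: "\<And>i x. x \<in> K \<Longrightarrow> cmod (s i x) \<le> B"
    and lim: "\<And>x. x \<in> K \<Longrightarrow> (\<lambda>i. s i x) \<longlonglongrightarrow> f x"
  shows "approximable f"
proof -
  have fB: "cmod (f x) \<le> B" if "x \<in> K" for x
    using LIMSEQ_le_const2[OF tendsto_norm[OF lim[OF that]]] bound[OF that] by blast
  have "f \<in> borel_measurable (lebesgue_on K)"
    by (rule borel_measurable_LIMSEQ_metric[where f=s])
      (use s approximable_L2 L2_measurable lim in auto)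
  then have f: "f \<in> L2 K" using fB by (rule L2_bounded)
  show ?thesis
  proof (rule approximable_dominated[OF s L2_const[of "of_real (2 * B)"] f _ lim])
    fix i x assume x: "x \<in> K"
    then have "0 \<le> B" using fB norm_ge_zero order_trans by blast
    then show "cmod (f x - s i x) \<le> cmod (of_real (2 * B))"
      using norm_triangle_ineq4[of "f x" "s i x"] fB[OF x] bound[OF x, of i]
      by (simp only: norm_of_real)
  qed
qed

lemma approximable_polynomial:
  assumes f: "approximable (\<lambda>x. complex_of_real (f x))" "\<And>x. x \<in> K \<Longrightarrow> \<bar>f x\<bar> \<le> B"
    and p: "real_polynomial_function p"
  shows "approximable (\<lambda>x. complex_of_real (p (f x)))"
  using p
proof (induction p rule: real_polynomial_function.induct)
  case (linear p)
  have "p (f x) = p 1 * f x" for x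
    using linear_cmul[OF bounded_linear.linear[OF linear], of "f x" 1] by simp
  then show ?case using approximable_cmult[OF f(1), of "of_real (p 1)"] by simp
next
  case (mult p r)
  have "compact (p ` {-B..B})"
    using mult(1) by (intro compact_continuous_image)
      (auto simp: real_polynomial_function_eq intro: continuous_on_polymonial_function)
  then obtain C where "\<And>y. y \<in> {-B..B} \<Longrightarrow> \<bar>p y\<bar> \<le> C"
    using compact_imp_bounded bounded_iff by (metis image_eqI real_norm_def)
  moreover have "\<And>x. x \<in> K \<Longrightarrow> f x \<in> {-B..B}" using f(2) by (simp add: abs_le_iff minus_le_iff)
  ultimately have "\<And>x. x \<in> K \<Longrightarrow> cmod (complex_of_real (p (f x))) \<le> C" by simp
  from approximable_mult[OF mult.IH(1) this mult.IH(2)] show ?case by simp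
qed (auto simp: approximable_const intro: approximable_add)

text \<open>By the Weierstrass theorem \<open>h\<close> is a uniform limit of polynomials on the range of \<open>f\<close>, and
  polynomials in \<open>f\<close> are approximable since bounded approximable functions can be multiplied.\<close>

lemma approximable_continuous:
  assumes f: "approximable (\<lambda>x. complex_of_real (f x))" "\<And>x. x \<in> K \<Longrightarrow> \<bar>f x\<bar> \<le> B"
    and h: "continuous_on UNIV h"
  shows "approximable (\<lambda>x. complex_of_real (h (f x)))"
proof -
  have "\<exists>p. real_polynomial_function p \<and> (\<forall>y\<in>{-B..B}. \<bar>h y - p y\<bar> < inverse (Suc n))" for n :: nat
    using Stone_Weierstrass_real_polynomial_function[of "{-B..B}" h "inverse (Suc n)"] h
    by (metis compact_Icc continuous_on_subset inverse_positive_iff_positive of_nat_0_less_iff subset_UNIV zero_less_Suc)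
  then obtain p where p: "\<And>n. real_polynomial_function (p n)"
      "\<And>n y. y \<in> {-B..B} \<Longrightarrow> \<bar>h y - p n y\<bar> < inverse (Suc n)"
    by metis
  have "compact (h ` {-B..B})"
    using h by (intro compact_continuous_image) (auto intro: continuous_on_subset)
  then obtain C where C: "\<And>y. y \<in> {-B..B} \<Longrightarrow> \<bar>h y\<bar> \<le> C"
    using compact_imp_bounded bounded_iff by (metis image_eqI real_norm_def)
  show ?thesis
  proof (rule approximable_bounded_limit[where s="\<lambda>n x. complex_of_real (p n (f x))" and B="C + 1"])
    show "approximable (\<lambda>x. complex_of_real (p n (f x)))" for n
      by (rule approximable_polynomial[OF f p(1)])
    fix x assume x: "x \<in> K"
    then have fx: "f x \<in> {-B..B}" using f(2)[OF x] by auto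
    show "cmod (complex_of_real (p n (f x))) \<le> C + 1" for n
    proof -
      have "inverse (real (Suc n)) \<le> 1" by (simp add: field_simps)
      then show ?thesis using p(2)[OF fx, of n] C[OF fx] by (simp only: norm_of_real)
    qed
    have "(\<lambda>n. p n (f x)) \<longlonglongrightarrow> h (f x)"
    proof (rule LIM_zero_cancel, rule Lim_null_comparison[OF _ LIMSEQ_inverse_real_of_nat])
      show "\<forall>\<^sub>F n in sequentially. norm (p n (f x) - h (f x)) \<le> inverse (real (Suc n))"
        using p(2)[OF fx] by (intro always_eventually allI) (simp add: abs_minus_commute less_imp_le)
    qed
    then show "(\<lambda>n. complex_of_real (p n (f x))) \<longlonglongrightarrow> complex_of_real (h (f x))"
      by (rule tendsto_of_real)
  qed
qed

lemma AE_lebesgue_on_K: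
  assumes "AE x in lebesgue. P x"
  shows "AE x in lebesgue_on K. P x"
proof -
  have "K \<inter> space lebesgue \<in> sets lebesgue" by (simp add: K_box)
  from AE_restrict_space_iff[OF this] assms show ?thesis
    by (simp add: eventually_mono)
qed

definition approx_set :: "(real ^ 'n) set \<Rightarrow> bool" where
  "approx_set S \<longleftrightarrow> approximable (indicator S)"

text \<open>The indicator is the increasing limit of continuous cut-offs of \<open>f\<close>.\<close>

lemma approx_set_greater:
  assumes f: "approximable (\<lambda>x. complex_of_real (f x))" "\<And>x. x \<in> K \<Longrightarrow> \<bar>f x\<bar> \<le> B"
  shows "approx_set {x. f x > c}"
  unfolding approx_set_def
proof (rule approximable_bounded_limit[where B=1
      and s="\<lambda>n x. complex_of_real (min 1 (real n * max 0 (f x - c)))"])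
  show "approximable (\<lambda>x. complex_of_real (min 1 (real n * max 0 (f x - c))))" for n
    by (rule approximable_continuous[OF f, of "\<lambda>y. min 1 (real n * max 0 (y - c))"])
      (auto intro!: continuous_intros)
  show "cmod (complex_of_real (min 1 (real n * max 0 (f x - c)))) \<le> 1" for n x
    by (simp only: norm_of_real) (simp add: abs_le_iff min_def)
  fix x
  have "(\<lambda>n. min 1 (real n * max 0 (f x - c))) \<longlonglongrightarrow> indicator {x. f x > c} x"
  proof (cases "f x > c")
    case True
    then obtain m :: nat where m: "1 < real m * (f x - c)"
      using reals_Archimedean3[of "f x - c"] by auto
    have "min 1 (real n * max 0 (f x - c)) = 1" if "n \<ge> m" for n
    proof -
      have "real m * (f x - c) \<le> real n * (f x - c)" using that True by (intro mult_right_mono) auto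
      then have "1 \<le> real n * (f x - c)" using m by linarith
      then show ?thesis using True by (simp add: min_def)
    qed
    then show ?thesis using True
      by (intro tendsto_eventually) (auto simp: eventually_sequentially)
  qed simp
  from tendsto_of_real[OF this]
  show "(\<lambda>n. complex_of_real (min 1 (real n * max 0 (f x - c)))) \<longlonglongrightarrow> indicator {x. f x > c} x"
    by (simp only: of_real_indicator)
qed

lemma approx_set_empty: "approx_set {}"
  unfolding approx_set_def by (rule approximable_cong[OF approximable_const[of 0]]) simp

lemma approx_set_Compl: "approx_set S \<Longrightarrow> approx_set (- S)"
  unfolding approx_set_def
  using approximable_diff[OF approximable_const[of 1], of "indicator S"]
  by (rule approximable_cong) (auto simp: indicator_def)

lemma approx_set_Int: "approx_set S \<Longrightarrow> approx_set T \<Longrightarrow> approx_set (S \<inter> T)"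
  unfolding approx_set_def
  by (rule approximable_cong[OF approximable_mult[of "indicator S" 1 "indicator T"]])
    (auto simp: indicator_def)

lemma approx_set_Un: "approx_set S \<Longrightarrow> approx_set T \<Longrightarrow> approx_set (S \<union> T)"
  using approx_set_Compl[OF approx_set_Int[OF approx_set_Compl[of S] approx_set_Compl[of T]]] by simp

text \<open>Finite unions come from complements and intersections; the countable union is their bounded
  pointwise limit.\<close>

lemma approx_set_UN:
  assumes "\<And>i::nat. approx_set (A i)"
  shows "approx_set (\<Union>i. A i)"
  unfolding approx_set_def
proof (rule approximable_bounded_limit[where B=1 and s="\<lambda>n. indicator (\<Union>i<n. A i)"])
  have "approx_set (\<Union>i<n. A i)" for n
    by (induction n) (use assms in \<open>auto simp: approx_set_empty lessThan_Suc intro: approx_set_Un\<close>)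
  then show "approximable (indicator (\<Union>i<n. A i))" for n by (simp add: approx_set_def)
  show "cmod (indicator (\<Union>i<n. A i) x) \<le> 1" for n x by (simp add: indicator_def)
  show "(\<lambda>n. indicator (\<Union>i<n. A i) x) \<longlonglongrightarrow> (indicator (\<Union>i. A i) x :: complex)" for x
    by (rule LIMSEQ_indicator_UN)
qed

lemma approx_set_cong_AE:
  assumes "approx_set S" "AE x in lebesgue_on K. x \<in> S \<longleftrightarrow> x \<in> T" "T \<in> sets lebesgue"
  shows "approx_set T"
  unfolding approx_set_def
proof (rule approximable_cong_AE[OF assms(1)[unfolded approx_set_def]])
  show "AE x in lebesgue_on K. indicator S x = indicator T x"
    using assms(2) by eventually_elim (simp add: indicator_def)
  have "(indicator T :: _ \<Rightarrow> complex) \<in> borel_measurable lebesgue"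
    using assms(3) by (rule borel_measurable_indicator)
  then show "indicator T \<in> L2 K"
    by (intro L2_bounded[where B=1] measurable_restrict_space1) (auto simp: indicator_def)
qed

lemma approximable_cos_sin:
  fixes i :: 'n and \<alpha> :: real
  shows "approximable (\<lambda>x. complex_of_real (cos (q $ i * (x $ i - \<alpha>))))"
    and "approximable (\<lambda>x. complex_of_real (sin (q $ i * (x $ i - \<alpha>))))"
proof -
  define \<xi> where "\<xi> = axis i (q $ i)"
  have \<xi>: "\<xi> \<in> dual_lattice q" by (simp add: \<xi>_def dual_lattice_axis)
  define z where "z x = cis (- q $ i * \<alpha>) * wave \<xi> x" for x
  have z: "z x = cis (q $ i * (x $ i - \<alpha>))" for x
    by (simp add: z_def wave_def \<xi>_def cis_mult inner_axis' algebra_simps)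
  have 1: "approximable z"
    unfolding z_def by (intro approximable_trig trig_cmult_wave \<xi>)
  have "cnj (z x) = cis (q $ i * \<alpha>) * wave (- \<xi>) x" for x
    by (simp add: z_def cnj_wave cis_cnj)
  then have 2: "approximable (\<lambda>x. cnj (z x))"
    by (auto intro!: approximable_trig trig_cmult_wave dual_lattice_uminus \<xi>)
  show "approximable (\<lambda>x. complex_of_real (cos (q $ i * (x $ i - \<alpha>))))"
    by (rule approximable_cong[OF approximable_cmult[OF approximable_add[OF 1 2], of "1/2"]])
      (simp add: z complex_eq_iff)
  show "approximable (\<lambda>x. complex_of_real (sin (q $ i * (x $ i - \<alpha>))))"
    by (rule approximable_cong[OF approximable_cmult[OF approximable_diff[OF 1 2], of "-\<i>/2"]])
      (simp add: z complex_eq_iff)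
qed

text \<open>With the angle \<open>\<theta>\<close> running from \<open>0\<close> to \<open>2 \<pi>\<close> along the edge in direction \<open>i\<close>, the sign of
  \<open>sin \<theta>\<close> tells in which half of the edge a point lies, and \<open>cos \<theta>\<close> is monotone on each half.
  Only on the face \<open>\<theta> = 2 \<pi>\<close>, which trigonometric functions cannot distinguish from
  \<open>\<theta> = 0\<close>, does the resulting description fail; this face is a null set.\<close>

lemma approx_set_halfspace: "approx_set {x. x $ i \<le> c}"
proof -
  define \<theta> where "\<theta> x = q $ i * (x $ i - a $ i)" for x :: "real ^ 'n"
  define t where "t = q $ i * (c - a $ i)"
  have q: "q $ i > 0" by (rule q_pos)
  have \<theta>: "0 \<le> \<theta> x \<and> \<theta> x \<le> 2 * pi" if "x \<in> K" for x
  proof -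
    have "0 \<le> x $ i - a $ i" "x $ i - a $ i \<le> 2 * pi / q $ i"
      using that sides[of i] by (auto simp: K_box mem_box_cart dest: spec[of _ i])
    then show ?thesis using q by (auto simp: \<theta>_def field_simps)
  qed
  have le_iff: "x $ i \<le> c \<longleftrightarrow> \<theta> x \<le> t" for x using q by (simp add: \<theta>_def t_def)
  have "{x. x $ i = b $ i} \<in> null_sets lebesgue"
    using negligible_standard_hyperplane[of "axis i 1 :: real ^ 'n" "b $ i"]
    by (simp add: negligible_iff_null_sets inner_axis)
  from AE_not_in[OF this] have "AE x in lebesgue. \<not> x $ i = b $ i" by simp
  then have ae: "AE x in lebesgue_on K. \<theta> x \<noteq> 2 * pi"
  proof -
    have "AE x in lebesgue_on K. \<not> x $ i = b $ i"
      using \<open>AE x in lebesgue. \<not> x $ i = b $ i\<close> by (rule AE_lebesgue_on_K)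
    then show ?thesis
    proof eventually_elim
      case (elim x)
      have "\<theta> x = 2 * pi \<longleftrightarrow> x $ i - a $ i = b $ i - a $ i"
        using q by (subst sides) (auto simp: \<theta>_def field_simps)
      then show ?case using elim by simp
    qed
  qed
  have aeK: "AE x in lebesgue_on K. x \<in> K" by (rule AE_I2) simp
  have meas: "{x. x $ i \<le> c} \<in> sets lebesgue"
    by (intro sets_completionI_sets) (simp add: borel_closed closed_halfspace_component_le_cart)
  have cs: "approximable (\<lambda>x. complex_of_real (cos (\<theta> x)))" "approximable (\<lambda>x. complex_of_real (sin (\<theta> x)))"
    unfolding \<theta>_def by (rule approximable_cos_sin)+
  have cs': "approximable (\<lambda>x. complex_of_real (- cos (\<theta> x)))" "approximable (\<lambda>x. complex_of_real (- sin (\<theta> x)))"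
    using approximable_cmult[OF cs(1), where c="-1"] approximable_cmult[OF cs(2), where c="-1"]
    by simp_all
  note gt = cs[THEN approx_set_greater[where B=1]] cs'[THEN approx_set_greater[where B=1]]
  consider "t < 0" | "0 \<le> t" "t < pi" | "pi \<le> t" "t < 2 * pi" | "2 * pi \<le> t" by linarith
  then show ?thesis
  proof cases
    case 1
    from aeK have "AE x in lebesgue_on K. x \<in> {} \<longleftrightarrow> x \<in> {x. x $ i \<le> c}"
    proof eventually_elim
      case (elim x)
      then show ?case using \<theta>[OF elim] 1 by (simp add: le_iff)
    qed
    with approx_set_empty show ?thesis using meas by (rule approx_set_cong_AE)
  next
    case 2
    let ?T = "- ({x. - cos (\<theta> x) > - cos t} \<union> {x. - sin (\<theta> x) > 0})"
    have "approx_set ?T" by (intro approx_set_Compl approx_set_Un gt) (simp_all add: abs_le_iff)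
    moreover have "AE x in lebesgue_on K. x \<in> ?T \<longleftrightarrow> x \<in> {x. x $ i \<le> c}"
      using ae aeK
    proof eventually_elim
      case (elim x)
      then have *: "0 \<le> \<theta> x" "\<theta> x < 2 * pi" using \<theta>[of x] by auto
      show ?case
      proof (cases "\<theta> x \<le> pi")
        case True
        then have "sin (\<theta> x) \<ge> 0" using * by (intro sin_ge_zero)
        moreover have "cos t \<le> cos (\<theta> x) \<longleftrightarrow> \<theta> x \<le> t"
          using cos_mono_le_eq[of t "\<theta> x"] 2 * True by simp
        ultimately show ?thesis by (simp add: le_iff not_less)
      next
        case False
        then have "sin (\<theta> x) < 0" using * by (intro sin_lt_zero) auto
        then show ?thesis using False 2 by (simp add: le_iff)
      qed
    qed
    ultimately show ?thesis using meas by (rule approx_set_cong_AE)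
  next
    case 3
    let ?T = "- ({x. cos (\<theta> x) > cos t} \<inter> {x. - sin (\<theta> x) > 0})"
    have "approx_set ?T" by (intro approx_set_Compl approx_set_Int gt) (simp_all add: abs_le_iff)
    moreover have "AE x in lebesgue_on K. x \<in> ?T \<longleftrightarrow> x \<in> {x. x $ i \<le> c}"
      using ae aeK
    proof eventually_elim
      case (elim x)
      then have *: "0 \<le> \<theta> x" "\<theta> x < 2 * pi" using \<theta>[of x] by auto
      show ?case
      proof (cases "\<theta> x \<le> pi")
        case True
        then have "sin (\<theta> x) \<ge> 0" using * by (intro sin_ge_zero)
        then show ?thesis using True 3 by (simp add: le_iff)
      next
        case False
        then have "sin (\<theta> x) < 0" using * by (intro sin_lt_zero) auto
        moreover have "cos (\<theta> x) \<le> cos t \<longleftrightarrow> \<theta> x \<le> t"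
          using cos_mono_le_eq[of "2 * pi - \<theta> x" "2 * pi - t"] 3 * False by simp
        ultimately show ?thesis by (simp add: le_iff not_less)
      qed
    qed
    ultimately show ?thesis using meas by (rule approx_set_cong_AE)
  next
    case 4
    from aeK have "AE x in lebesgue_on K. x \<in> - {} \<longleftrightarrow> x \<in> {x. x $ i \<le> c}"
    proof eventually_elim
      case (elim x)
      then show ?case using \<theta>[OF elim] 4 by (simp add: le_iff)
    qed
    with approx_set_Compl[OF approx_set_empty] show ?thesis using meas by (rule approx_set_cong_AE)
  qed
qed

lemma approx_set_borel:
  assumes "S \<in> sets borel"
  shows "approx_set S"
proof -
  have "S \<in> sets (sigma UNIV ((\<lambda>(c, e). {x :: real ^ 'n. x \<bullet> e \<le> c}) ` (UNIV \<times> Basis)))"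
    using assms by (simp only: borel_eq_halfspace_le[symmetric])
  then have "S \<in> sigma_sets UNIV ((\<lambda>(c, e). {x. x \<bullet> e \<le> c}) ` (UNIV \<times> Basis))"
    by (simp only: sets_measure_of subset_UNIV Pow_UNIV)
  then show ?thesis
  proof (induction rule: sigma_sets.induct)
    case (Basic S)
    then obtain c i where "S = {x. x \<bullet> axis i 1 \<le> c}" by (auto simp: Basis_vec_def)
    then show ?case using approx_set_halfspace[of i c] by (simp add: inner_axis)
  next
    case (Compl S)
    then show ?case using approx_set_Compl by (simp only: Compl_eq_Diff_UNIV)
  next
    case (Union A)
    then show ?case by (intro approx_set_UN)
  qed (rule approx_set_empty)
qed

lemma approx_set_lebesgue:
  assumes "S \<in> sets lebesgue"
  shows "approx_set S"
proof -
  obtain S' N N' where S: "S = S' \<union> N" "N \<subseteq> N'" "N' \<in> null_sets lborel" "S' \<in> sets lborel"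
    using assms by (rule sets_completionE)
  have "AE x in lebesgue. x \<notin> N'"
    by (rule AE_completion[OF AE_not_in[OF S(3)]])
  then have "AE x in lebesgue. x \<in> S' \<longleftrightarrow> x \<in> S"
  proof (rule eventually_mono)
    fix x assume "x \<notin> N'"
    then show "x \<in> S' \<longleftrightarrow> x \<in> S" using S(2) by (subst S(1)) auto
  qed
  then have "AE x in lebesgue_on K. x \<in> S' \<longleftrightarrow> x \<in> S"
    by (rule AE_lebesgue_on_K)
  moreover have "approx_set S'" using S(4) by (intro approx_set_borel) simp
  ultimately show ?thesis using approx_set_cong_AE assms by blast
qed

theorem L2_approximable:
  assumes "f \<in> L2 K"
  shows "approximable f"
proof -
  obtain F where "\<forall>i. simple_function (lebesgue_on K) (F i)" "\<forall>x\<in>K. (\<lambda>i. F i x) \<longlonglongrightarrow> f x"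
    "\<forall>i. \<forall>x\<in>K. dist (F i x) 0 \<le> 2 * dist (f x) 0"
    using borel_measurable_implies_sequence_metric[OF L2_measurable[OF assms], of 0]
    unfolding space_K by metis
  then have F: "\<And>i. simple_function (lebesgue_on K) (F i)"
    "\<And>x. x \<in> K \<Longrightarrow> (\<lambda>i. F i x) \<longlonglongrightarrow> f x"
    "\<And>i x. x \<in> K \<Longrightarrow> cmod (F i x) \<le> 2 * cmod (f x)"
    unfolding dist_norm diff_zero by metis+
  show ?thesis
  proof (rule approximable_dominated[where s=F and h="\<lambda>x. 3 * f x"])
    fix i
    have "approximable (\<lambda>x. \<Sum>y\<in>F i ` K. y * indicator (F i -` {y} \<inter> K) x)"
    proof (rule approximable_sum, rule approximable_cmult, rule approx_set_lebesgue[unfolded approx_set_def])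
      fix y
      have "F i -` {y} \<inter> K \<in> sets (lebesgue_on K)"
        using simple_functionD(2)[OF F(1)[of i], of "{y}"] by (simp only: space_K)
      then show "F i -` {y} \<inter> K \<in> sets lebesgue"
        using sets_restrict_space_iff[of K lebesgue] K_measurable by (simp add: fmeasurableD)
    qed
    then show "approximable (F i)"
    proof (rule approximable_cong)
      fix x assume "x \<in> K"
      then show "(\<Sum>y\<in>F i ` K. y * indicator (F i -` {y} \<inter> K) x) = F i x"
        using simple_function_indicator_representation_banach[OF F(1), of x i]
        by (simp only: space_K scaleR_conv_of_real mult.commute of_real_indicator)
    qed
    fix x assume "x \<in> K"
    then show "cmod (f x - F i x) \<le> cmod (3 * f x)"
      using F(3)[of x i] norm_triangle_ineq4[of "f x" "F i x"] by (simp add: norm_mult)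
    from \<open>x \<in> K\<close> show "(\<lambda>i. F i x) \<longlonglongrightarrow> f x" by (rule F(2))
  qed (rule L2_cmult[OF assms], rule assms)
qed

section \<open>Fourier multipliers\<close>

definition vol :: real where
  "vol = measure lebesgue K"

lemma vol_pos: "vol > 0"
proof -
  have "a $ i < b $ i" for i
  proof -
    have "b $ i - a $ i > 0" unfolding sides using q_pos[of i] by simp
    then show ?thesis by simp
  qed
  then have "\<forall>e\<in>Basis. a \<bullet> e < b \<bullet> e" by (auto simp: Basis_vec_def inner_axis)
  then show ?thesis unfolding vol_def by (simp add: K_box content_pos_lt)
qed

lemma L2_inner_wave_wave:
  assumes "\<xi> \<in> dual_lattice q" "\<eta> \<in> dual_lattice q"
  shows "L2_inner K (wave \<xi>) (wave \<eta>) = (if \<xi> = \<eta> then of_real vol else 0)"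
proof -
  have eq: "cnj (wave \<xi> x) * wave \<eta> x = wave (\<eta> - \<xi>) x" for x
    by (simp add: cnj_wave wave_mult)
  show ?thesis
  proof (cases "\<xi> = \<eta>")
    case True
    have "measure (lebesgue_on K) K = vol"
      using measure_restrict_space[of K lebesgue K] K_measurable by (simp add: vol_def fmeasurableD)
    then have "(LINT x|lebesgue_on K. 1 :: complex) = of_real vol"
      by (simp add: scaleR_conv_of_real)
    then show ?thesis unfolding L2_inner_def eq using True by (simp add: wave_zero)
  next
    case False
    then show ?thesis unfolding L2_inner_def eq
      using integral_wave_eq_0[OF q_pos sides dual_lattice_diff[OF assms(2,1)]] by (simp add: K_box)
  qed
qed

definition fourier_proj :: "(real ^ 'n) set \<Rightarrow> (real ^ 'n \<Rightarrow> complex) \<Rightarrow> real ^ 'n \<Rightarrow> complex" where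
  "fourier_proj F f = (\<lambda>x. \<Sum>\<xi>\<in>F. (L2_inner K (wave \<xi>) f / vol) * wave \<xi> x)"

lemma fourier_proj_L2: "fourier_proj F f \<in> L2 K"
  unfolding fourier_proj_def by (intro L2_sum L2_cmult L2_wave)

text \<open>The residual of the orthogonal projection is orthogonal to every plane wave with frequency in
  \<open>F\<close>, so changing the coefficients can only add to its norm. The approximant may use fewer
  frequencies than the projection, which lets one set of frequencies serve several functions.\<close>

lemma fourier_proj_best:
  assumes "finite F" "F \<subseteq> dual_lattice q" "G \<subseteq> F" and f: "f \<in> L2 K"
  shows "normsq K (\<lambda>x. f x - fourier_proj F f x) \<le> normsq K (\<lambda>x. f x - (\<Sum>\<xi>\<in>G. c \<xi> * wave \<xi> x))"
proof -
  let ?r = "\<lambda>x. f x - fourier_proj F f x"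
  define d where "d \<xi> = L2_inner K (wave \<xi>) f / vol - (if \<xi> \<in> G then c \<xi> else 0)" for \<xi>
  have r: "?r \<in> L2 K" by (intro L2_diff f fourier_proj_L2)
  have orth: "L2_inner K ?r (wave \<xi>) = 0" if "\<xi> \<in> F" for \<xi>
  proof -
    have "L2_inner K (wave \<xi>) (fourier_proj F f)
        = (\<Sum>\<eta>\<in>F. (L2_inner K (wave \<eta>) f / vol) * L2_inner K (wave \<xi>) (wave \<eta>))"
      unfolding fourier_proj_def
      by (simp only: L2_inner_sum_right L2_wave L2_cmult L2_inner_cmult_right)
    also have "\<dots> = (\<Sum>\<eta>\<in>F. if \<eta> = \<xi> then L2_inner K (wave \<xi>) f else 0)"
      using that assms(2) vol_pos by (intro sum.cong) (auto simp: L2_inner_wave_wave subset_iff)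
    also have "\<dots> = L2_inner K (wave \<xi>) f" using that assms(1) by simp
    finally have "L2_inner K (wave \<xi>) ?r = 0" by (simp add: L2_inner_diff_right L2_wave f fourier_proj_L2)
    then show ?thesis by (subst cnj_L2_inner[symmetric]) simp
  qed
  have "(\<Sum>\<xi>\<in>G. c \<xi> * wave \<xi> x) = (\<Sum>\<xi>\<in>F. (if \<xi> \<in> G then c \<xi> else 0) * wave \<xi> x)" for x
    using assms(1,3) by (intro sum.mono_neutral_cong_left) auto
  then have split: "f x - (\<Sum>\<xi>\<in>G. c \<xi> * wave \<xi> x) = ?r x + (\<Sum>\<xi>\<in>F. d \<xi> * wave \<xi> x)" for x
    by (simp add: fourier_proj_def d_def left_diff_distrib sum_subtractf)
  have dL2: "(\<lambda>x. \<Sum>\<xi>\<in>F. d \<xi> * wave \<xi> x) \<in> L2 K" by (intro L2_sum L2_cmult L2_wave)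
  have "L2_inner K ?r (\<lambda>x. \<Sum>\<xi>\<in>F. d \<xi> * wave \<xi> x) = (\<Sum>\<xi>\<in>F. d \<xi> * L2_inner K ?r (wave \<xi>))"
    by (simp only: L2_inner_sum_right r L2_wave L2_cmult L2_inner_cmult_right)
  also have "\<dots> = 0" using orth by simp
  finally show ?thesis unfolding split normsq_add[OF r dL2] by (simp add: normsq_nonneg)
qed

text \<open>Two operators that act on Fourier coefficients by conjugate multipliers are adjoint to each
  other. On finite Fourier projections this is a term-by-term identity, and density lets one pass
  to the limit. The multipliers may be unbounded: it is enough that \<open>u'\<close> and \<open>v'\<close> are square
  integrable. The choices \<open>i \<xi>\<^sub>i\<close> and \<open>- \<bar>\<xi>\<bar>\<^sup>2\<close> give integration by parts and the symmetry of the
  Laplacian.\<close>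

lemma multiplier_adjoint:
  assumes u: "u \<in> L2 K" "u' \<in> L2 K" and v: "v \<in> L2 K" "v' \<in> L2 K"
    and u': "\<And>\<xi>. \<xi> \<in> dual_lattice q \<Longrightarrow> L2_inner K (wave \<xi>) u' = c \<xi> * L2_inner K (wave \<xi>) u"
    and v': "\<And>\<xi>. \<xi> \<in> dual_lattice q \<Longrightarrow> L2_inner K (wave \<xi>) v' = cnj (c \<xi>) * L2_inner K (wave \<xi>) v"
  shows "L2_inner K u' v = L2_inner K u v'"
proof -
  have ex: "\<exists>G c. finite G \<and> G \<subseteq> dual_lattice q \<and> normsq K (\<lambda>x. f x - (\<Sum>\<xi>\<in>G. c \<xi> * wave \<xi> x)) < inverse (Suc n)"
    if f: "f \<in> L2 K" for f n
  proof -
    have "inverse (real (Suc n)) > 0" by simp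
    with L2_approximable[OF f] have "\<exists>p\<in>trig. normsq K (\<lambda>x. f x - p x) < inverse (Suc n)"
      unfolding approximable_def by blast
    then show ?thesis unfolding trig_def by blast
  qed
  have "\<exists>F. finite F \<and> F \<subseteq> dual_lattice q \<and> normsq K (\<lambda>x. u x - fourier_proj F u x) \<le> inverse (Suc n)
      \<and> normsq K (\<lambda>x. u' x - fourier_proj F u' x) \<le> inverse (Suc n)" for n
  proof -
    obtain G g where G: "finite G" "G \<subseteq> dual_lattice q"
        "normsq K (\<lambda>x. u x - (\<Sum>\<xi>\<in>G. g \<xi> * wave \<xi> x)) < inverse (Suc n)"
      using ex[OF u(1)] by blast
    obtain H h where H: "finite H" "H \<subseteq> dual_lattice q"
        "normsq K (\<lambda>x. u' x - (\<Sum>\<xi>\<in>H. h \<xi> * wave \<xi> x)) < inverse (Suc n)"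
      using ex[OF u(2)] by blast
    have GH: "finite (G \<union> H)" "G \<union> H \<subseteq> dual_lattice q" using G H by simp_all
    from fourier_proj_best[OF GH Un_upper1 u(1), of g] fourier_proj_best[OF GH Un_upper2 u(2), of h] G(3) H(3)
    have "normsq K (\<lambda>x. u x - fourier_proj (G \<union> H) u x) \<le> inverse (Suc n)"
      "normsq K (\<lambda>x. u' x - fourier_proj (G \<union> H) u' x) \<le> inverse (Suc n)"
      by linarith+
    with GH show ?thesis by blast
  qed
  then have "\<exists>F. \<forall>n. finite (F n) \<and> F n \<subseteq> dual_lattice q \<and> normsq K (\<lambda>x. u x - fourier_proj (F n) u x) \<le> inverse (Suc n)
      \<and> normsq K (\<lambda>x. u' x - fourier_proj (F n) u' x) \<le> inverse (Suc n)"
    by (intro choice allI)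
  then obtain F where F: "\<And>n. finite (F n)" "\<And>n. F n \<subseteq> dual_lattice q"
    "\<And>n. normsq K (\<lambda>x. u x - fourier_proj (F n) u x) \<le> inverse (Suc n)"
    "\<And>n. normsq K (\<lambda>x. u' x - fourier_proj (F n) u' x) \<le> inverse (Suc n)"
    by auto
  have null: "(\<lambda>n. normsq K (f n)) \<longlonglongrightarrow> 0" if "\<And>n. normsq K (f n) \<le> inverse (Suc n)" for f
    by (rule Lim_null_comparison[OF _ LIMSEQ_inverse_real_of_nat], rule always_eventually)
      (simp add: normsq_nonneg that del: of_nat_Suc)
  have expand: "L2_inner K (fourier_proj (F n) f) g
      = (\<Sum>\<xi>\<in>F n. cnj (L2_inner K (wave \<xi>) f / vol) * L2_inner K (wave \<xi>) g)"
    if "g \<in> L2 K" for f g n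
    unfolding fourier_proj_def
    by (simp only: L2_inner_sum_left that L2_wave L2_cmult L2_inner_cmult_left)
  \<comment> \<open>The sets \<open>F n\<close> serve both \<open>u\<close> and \<open>u'\<close>, so the two projections can be compared termwise.\<close>
  have eq: "L2_inner K (fourier_proj (F n) u') v = L2_inner K (fourier_proj (F n) u) v'" for n
    unfolding expand[OF v(1)] expand[OF v(2)]
  proof (rule sum.cong[OF refl])
    fix \<xi> assume "\<xi> \<in> F n"
    then have "\<xi> \<in> dual_lattice q" using F(2) by blast
    then show "cnj (L2_inner K (wave \<xi>) u' / vol) * L2_inner K (wave \<xi>) v
        = cnj (L2_inner K (wave \<xi>) u / vol) * L2_inner K (wave \<xi>) v'"
      by (simp add: u' v')
  qed
  have "(\<lambda>n. L2_inner K (fourier_proj (F n) u') v) \<longlonglongrightarrow> L2_inner K u' v"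
    by (rule L2_inner_tendsto_left[OF fourier_proj_L2 u(2) v(1) null]) (rule F(4))
  moreover have "(\<lambda>n. L2_inner K (fourier_proj (F n) u') v) \<longlonglongrightarrow> L2_inner K u v'"
    unfolding eq by (rule L2_inner_tendsto_left[OF fourier_proj_L2 u(1) v(2) null]) (rule F(3))
  ultimately show ?thesis by (rule LIMSEQ_unique)
qed

lemmas weak_coeff = weak_partial_deriv_coeff[OF q_pos]

lemma weak_partial_deriv_by_parts:
  assumes "weak_partial_deriv K q i u u'" "weak_partial_deriv K q i v v'"
  shows "L2_inner K u' v = - L2_inner K u v'"
proof -
  have L2: "u \<in> L2 K" "u' \<in> L2 K" "v \<in> L2 K" "v' \<in> L2 K"
    using assms by (auto simp: weak_partial_deriv_def)
  have "L2_inner K u' v = L2_inner K u (\<lambda>x. (-1) * v' x)"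
  proof (rule multiplier_adjoint[where c="\<lambda>\<xi>. \<i> * of_real (\<xi> $ i)"])
    fix \<xi> assume \<xi>: "\<xi> \<in> dual_lattice q"
    show "L2_inner K (wave \<xi>) u' = \<i> * of_real (\<xi> $ i) * L2_inner K (wave \<xi>) u"
      by (rule weak_coeff[OF \<xi> assms(1)])
    show "L2_inner K (wave \<xi>) (\<lambda>x. (-1) * v' x) = cnj (\<i> * of_real (\<xi> $ i)) * L2_inner K (wave \<xi>) v"
      unfolding L2_inner_cmult_right weak_coeff[OF \<xi> assms(2)] by simp
  qed (intro L2 L2_cmult)+
  then show ?thesis unfolding L2_inner_cmult_right by simp
qed

end

section \<open>Eigenfunctions and commutators with plane waves\<close>

text \<open>What the argument uses about an eigenfunction \<open>u\<close> with eigenvalue \<open>\<mu>\<close>: its weak gradient \<open>v\<close>, and a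
  square integrable representative \<open>w\<close> of its Laplacian. Choosing one such \<open>v\<close> and \<open>w\<close> for each
  eigenfunction fixes the null-set ambiguity in the relation defining the operator.\<close>

definition eigen_data ::
  "(real ^ 'n) set \<Rightarrow> real ^ 'n \<Rightarrow> (real ^ 'n \<Rightarrow> real) \<Rightarrow> real \<Rightarrow> (real ^ 'n \<Rightarrow> complex) \<Rightarrow>
    ('n \<Rightarrow> real ^ 'n \<Rightarrow> complex) \<Rightarrow> (real ^ 'n \<Rightarrow> complex) \<Rightarrow> bool" where
  "eigen_data K q V \<mu> u v w \<longleftrightarrow>
    (\<forall>i. weak_partial_deriv K q i u (v i)) \<and> w \<in> L2 K \<and>
    (\<forall>\<xi>\<in>dual_lattice q. L2_inner K (wave \<xi>) w = - of_real ((norm \<xi>)\<^sup>2) * L2_inner K (wave \<xi>) u) \<and>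
    L2_inner K u w = - of_real (\<Sum>i\<in>UNIV. normsq K (v i)) \<and>
    (AE x in lebesgue_on K. of_real \<mu> * u x = - w x + of_real (V x) * u x)"

locale torus_potential = torus_box q a b K
  for q a b :: "real ^ 'n" and K +
  fixes V :: "real ^ 'n \<Rightarrow> real"
  assumes V_measurable: "V \<in> borel_measurable lebesgue"
    and V_bounded: "bounded (range V)"
begin

lemma L2_V_mult: "f \<in> L2 K \<Longrightarrow> (\<lambda>x. of_real (V x) * f x) \<in> L2 K"
proof -
  assume f: "f \<in> L2 K"
  obtain B where B: "\<And>x. \<bar>V x\<bar> \<le> B" using V_bounded by (auto simp: bounded_iff)
  have "(\<lambda>x. complex_of_real (V x)) \<in> borel_measurable lebesgue"
    using V_measurable by measurable
  from L2_mult_bounded[OF f measurable_restrict_space1[OF this], of B]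
  show ?thesis using B by simp
qed

lemma schroedinger_eigen_data:
  assumes "schroedinger_per K q V u (\<lambda>x. of_real \<mu> * u x)"
  shows "\<exists>v w. eigen_data K q V \<mu> u v w"
proof -
  obtain w v z where
    v: "\<And>i. weak_partial_deriv K q i u (v i)" and z: "\<And>i. weak_partial_deriv K q i (v i) (z i)"
    and w: "AE x in lebesgue_on K. w x = (\<Sum>i\<in>UNIV. z i x)"
    and eq: "AE x in lebesgue_on K. of_real \<mu> * u x = - w x + of_real (V x) * u x"
    using assms unfolding schroedinger_per_def has_weak_laplacian_def by auto
  have u: "u \<in> L2 K" and zL2: "z i \<in> L2 K" for i
    using v[of i] z[of i] by (auto simp: weak_partial_deriv_def)
  define w' where "w' x = (\<Sum>i\<in>UNIV. z i x)" for x
  have "w' \<in> L2 K" unfolding w'_def by (intro L2_sum zL2)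
  moreover have "L2_inner K (wave \<xi>) w' = - of_real ((norm \<xi>)\<^sup>2) * L2_inner K (wave \<xi>) u"
    if \<xi>: "\<xi> \<in> dual_lattice q" for \<xi>
  proof -
    have "L2_inner K (wave \<xi>) (z i) = - of_real ((\<xi> $ i)\<^sup>2) * L2_inner K (wave \<xi>) u" for i
      unfolding weak_coeff[OF \<xi> z] weak_coeff[OF \<xi> v] by (simp add: power2_eq_square algebra_simps)
    then have "L2_inner K (wave \<xi>) w' = (\<Sum>i\<in>UNIV. - of_real ((\<xi> $ i)\<^sup>2) * L2_inner K (wave \<xi>) u)"
      unfolding w'_def by (simp add: L2_inner_sum_right L2_wave zL2)
    moreover have "(norm \<xi>)\<^sup>2 = (\<Sum>i\<in>UNIV. (\<xi> $ i)\<^sup>2)"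
      by (simp add: norm_vec_def L2_set_def sum_nonneg)
    ultimately show ?thesis by (simp add: sum_distrib_right sum_negf)
  qed
  moreover have "L2_inner K u w' = - of_real (\<Sum>i\<in>UNIV. normsq K (v i))"
  proof -
    have "L2_inner K u (z i) = - of_real (normsq K (v i))" for i
      using weak_partial_deriv_by_parts[OF v z, of i] by (simp add: L2_inner_self)
    then show ?thesis unfolding w'_def by (simp add: L2_inner_sum_right u zL2 sum_negf)
  qed
  moreover have "AE x in lebesgue_on K. of_real \<mu> * u x = - w' x + of_real (V x) * u x"
    using eq w by eventually_elim (simp add: w'_def)
  ultimately show ?thesis using v unfolding eigen_data_def by blast
qed

lemma eigen_data_L2:
  assumes "eigen_data K q V \<mu> u v w"
  shows "u \<in> L2 K" "v i \<in> L2 K" "w \<in> L2 K"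
  using assms by (auto simp: eigen_data_def weak_partial_deriv_def)

lemma eigen_data_inner_right:
  assumes "eigen_data K q V \<mu> u v w" "f \<in> L2 K"
  shows "of_real \<mu> * L2_inner K f u = L2_inner K f (\<lambda>x. of_real (V x) * u x) - L2_inner K f w"
proof -
  note L2 = eigen_data_L2[OF assms(1)]
  have "of_real \<mu> * L2_inner K f u = L2_inner K f (\<lambda>x. of_real \<mu> * u x)"
    by (simp only: L2_inner_cmult_right)
  also have "\<dots> = L2_inner K f (\<lambda>x. of_real (V x) * u x - w x)"
    using assms by (intro L2_inner_cong_AE L2_cmult L2_diff L2_V_mult L2) (auto simp: eigen_data_def)
  also have "\<dots> = L2_inner K f (\<lambda>x. of_real (V x) * u x) - L2_inner K f w"
    by (intro L2_inner_diff_right L2_V_mult L2 assms(2))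
  finally show ?thesis .
qed

text \<open>Pairing the eigenvalue equation with \<open>u\<close> splits \<open>\<mu>\<close> into kinetic and potential energy.\<close>

lemma kinetic_energy:
  assumes "eigen_data K q V \<mu> u v w" "L2_inner K u u = 1"
  shows "(\<Sum>i\<in>UNIV. normsq K (v i)) = \<mu> - Re (L2_inner K u (\<lambda>x. of_real (V x) * u x))"
proof -
  have "L2_inner K u w = - of_real (\<Sum>i\<in>UNIV. normsq K (v i))" using assms(1) by (simp add: eigen_data_def)
  with eigen_data_inner_right[OF assms(1) eigen_data_L2(1)[OF assms(1)]] assms(2)
  have "of_real \<mu> = L2_inner K u (\<lambda>x. of_real (V x) * u x) + of_real (\<Sum>i\<in>UNIV. normsq K (v i))"
    by simp
  from arg_cong[OF this, of Re] show ?thesis by simp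
qed

text \<open>For \<open>G = exp (i t x\<^sub>l)\<close> the commutator of \<open>H\<close> and \<open>G\<close> is \<open>G (t\<^sup>2 - 2 i t \<partial>\<^sub>l)\<close>, because the potential
  commutes with \<open>G\<close>. Its matrix elements between eigenfunctions are those of \<open>G\<close> times the
  difference of the eigenvalues. Since \<open>G u\<^sub>2\<close> is not known to be in the domain of \<open>H\<close>, the Laplacian
  of \<open>G u\<^sub>2\<close> is read off from Fourier coefficients: with \<open>\<xi> = \<zeta> + t e\<^sub>l\<close> one has
  \<open>\<bar>\<xi>\<bar>\<^sup>2 = \<bar>\<zeta>\<bar>\<^sup>2 + 2 t \<zeta>\<^sub>l + t\<^sup>2\<close>.\<close>

lemma commutator_matrix_element:
  assumes e1: "eigen_data K q V \<mu>1 u1 v1 w1" and e2: "eigen_data K q V \<mu>2 u2 v2 w2"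
    and lat: "axis l t \<in> dual_lattice q"
  shows "of_real (\<mu>1 - \<mu>2) * L2_inner K u1 (\<lambda>x. wave (axis l t) x * u2 x)
    = L2_inner K u1 (\<lambda>x. wave (axis l t) x * (of_real (t\<^sup>2) * u2 x - 2 * \<i> * of_real t * v2 l x))"
proof -
  define G where "G = wave (axis l t)"
  define \<eta> where "\<eta> x = of_real (t\<^sup>2) * u2 x - 2 * \<i> * of_real t * v2 l x" for x
  note L1 = eigen_data_L2[OF e1] and L2 = eigen_data_L2[OF e2]
  have GL2: "f \<in> L2 K \<Longrightarrow> (\<lambda>x. G x * f x) \<in> L2 K" for f unfolding G_def by (rule L2_wave_mult)
  have \<eta>: "\<eta> \<in> L2 K" unfolding \<eta>_def by (intro L2_diff L2_cmult L2)
  have "L2_inner K w1 (\<lambda>x. G x * u2 x) = L2_inner K u1 (\<lambda>x. G x * (w2 x - \<eta> x))"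
  proof (rule multiplier_adjoint[where c="\<lambda>\<xi>. - of_real ((norm \<xi>)\<^sup>2)"])
    fix \<xi> assume \<xi>: "\<xi> \<in> dual_lattice q"
    show "L2_inner K (wave \<xi>) w1 = - of_real ((norm \<xi>)\<^sup>2) * L2_inner K (wave \<xi>) u1"
      using e1 \<xi> by (simp add: eigen_data_def)
    define \<zeta> where "\<zeta> = \<xi> - axis l t"
    have \<zeta>: "\<zeta> \<in> dual_lattice q" unfolding \<zeta>_def using \<xi> lat by (rule dual_lattice_diff)
    have w: "L2_inner K (wave \<zeta>) w2 = - of_real ((norm \<zeta>)\<^sup>2) * L2_inner K (wave \<zeta>) u2"
      using e2 \<zeta> by (simp add: eigen_data_def)
    have v: "L2_inner K (wave \<zeta>) (v2 l) = \<i> * of_real (\<zeta> $ l) * L2_inner K (wave \<zeta>) u2"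
      using e2 by (intro weak_coeff[OF \<zeta>]) (simp add: eigen_data_def)
    have "\<xi> = \<zeta> + axis l t" by (simp add: \<zeta>_def)
    then have "(norm \<xi>)\<^sup>2 = (norm \<zeta>)\<^sup>2 + 2 * (\<zeta> \<bullet> axis l t) + axis l t \<bullet> axis l t"
      by (simp add: power2_norm_eq_inner inner_add_left inner_add_right inner_commute del: dot_square_norm)
    then have norm: "(norm \<xi>)\<^sup>2 = (norm \<zeta>)\<^sup>2 + 2 * t * \<zeta> $ l + t\<^sup>2"
      by (simp only: inner_axis) (simp add: power2_eq_square)
    have "L2_inner K (wave \<xi>) (\<lambda>x. G x * (w2 x - \<eta> x)) = L2_inner K (wave \<zeta>) (\<lambda>x. w2 x - \<eta> x)"
      unfolding G_def \<zeta>_def by (rule L2_inner_wave_wave_mult)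
    also have "\<dots> = L2_inner K (wave \<zeta>) w2 - (of_real (t\<^sup>2) * L2_inner K (wave \<zeta>) u2
        - 2 * \<i> * of_real t * L2_inner K (wave \<zeta>) (v2 l))"
      using \<eta> unfolding \<eta>_def
      by (simp only: L2_inner_diff_right L2_wave L2 L2_cmult L2_inner_cmult_right)
    also have "\<dots> = - of_real ((norm \<xi>)\<^sup>2) * L2_inner K (wave \<zeta>) u2"
      unfolding w v norm by (simp add: algebra_simps)
    also have "L2_inner K (wave \<zeta>) u2 = L2_inner K (wave \<xi>) (\<lambda>x. G x * u2 x)"
      unfolding G_def \<zeta>_def by (rule L2_inner_wave_wave_mult[symmetric])
    finally show "L2_inner K (wave \<xi>) (\<lambda>x. G x * (w2 x - \<eta> x))
        = cnj (- of_real ((norm \<xi>)\<^sup>2)) * L2_inner K (wave \<xi>) (\<lambda>x. G x * u2 x)" by simp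
  qed (intro L1 L2 GL2 L2_diff \<eta>)+
  also have "\<dots> = L2_inner K u1 (\<lambda>x. G x * w2 x) - L2_inner K u1 (\<lambda>x. G x * \<eta> x)"
    by (simp add: right_diff_distrib L2_inner_diff_right L1 L2 GL2 \<eta>)
  finally have w1: "L2_inner K w1 (\<lambda>x. G x * u2 x)
      = L2_inner K u1 (\<lambda>x. G x * w2 x) - L2_inner K u1 (\<lambda>x. G x * \<eta> x)" .
  have swap: "L2_inner K f (\<lambda>x. G x * g x) = L2_inner K (\<lambda>x. cnj (G x) * f x) g" for f g
    by (simp add: L2_inner_def mult_ac)
  have G'L2: "f \<in> L2 K \<Longrightarrow> (\<lambda>x. cnj (G x) * f x) \<in> L2 K" for f
    unfolding G_def cnj_wave by (rule L2_wave_mult)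
  have m2: "of_real \<mu>2 * L2_inner K u1 (\<lambda>x. G x * u2 x)
      = L2_inner K u1 (\<lambda>x. G x * (of_real (V x) * u2 x)) - L2_inner K u1 (\<lambda>x. G x * w2 x)"
    unfolding swap by (rule eigen_data_inner_right[OF e2 G'L2[OF L1(1)]])
  have "of_real \<mu>1 * L2_inner K (\<lambda>x. G x * u2 x) u1
      = L2_inner K (\<lambda>x. G x * u2 x) (\<lambda>x. of_real (V x) * u1 x) - L2_inner K (\<lambda>x. G x * u2 x) w1"
    by (rule eigen_data_inner_right[OF e1 GL2[OF L2(1)]])
  from arg_cong[OF this, of cnj]
  have m1: "of_real \<mu>1 * L2_inner K u1 (\<lambda>x. G x * u2 x)
      = L2_inner K (\<lambda>x. of_real (V x) * u1 x) (\<lambda>x. G x * u2 x) - L2_inner K w1 (\<lambda>x. G x * u2 x)"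
    by (simp add: cnj_L2_inner)
  have V: "L2_inner K (\<lambda>x. of_real (V x) * u1 x) (\<lambda>x. G x * u2 x)
      = L2_inner K u1 (\<lambda>x. G x * (of_real (V x) * u2 x))"
    by (simp add: L2_inner_def mult_ac)
  have "of_real (\<mu>1 - \<mu>2) * L2_inner K u1 (\<lambda>x. G x * u2 x) = L2_inner K u1 (\<lambda>x. G x * \<eta> x)"
    using m1 m2 unfolding w1 V by (simp add: left_diff_distrib)
  then show ?thesis unfolding G_def \<eta>_def .
qed

end

section \<open>The sum rule inequality\<close>

text \<open>The difference of the two sides is the limit of the sums of
  \<open>(z - \<lambda>\<^sub>j) (\<lambda>\<^sub>k - \<lambda>\<^sub>j) (z - \<lambda>\<^sub>k) S\<^sub>j\<^sub>k\<close> over \<open>j \<le> N\<close> and \<open>k \<le> n\<close>. The terms with \<open>k \<le> N\<close> are antisymmetric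
  in \<open>j\<close> and \<open>k\<close> and cancel; for \<open>k > N\<close> the three factors have signs \<open>+\<close>, \<open>+\<close>, \<open>-\<close>, as \<open>z\<close> lies
  in the gap between \<open>\<lambda>\<^sub>N\<close> and \<open>\<lambda>\<^sub>N\<^sub>+\<^sub>1\<close>.\<close>

lemma symmetric_moment_inequality:
  fixes lam :: "nat \<Rightarrow> real" and S :: "nat \<Rightarrow> nat \<Rightarrow> real"
  assumes mono: "\<And>j k. 1 \<le> j \<Longrightarrow> j \<le> k \<Longrightarrow> lam j \<le> lam k"
    and sym: "\<And>j k. 1 \<le> j \<Longrightarrow> 1 \<le> k \<Longrightarrow> S j k = S k j" and nonneg: "\<And>j k. 0 \<le> S j k"
    and first: "\<And>j. j \<in> {1..N} \<Longrightarrow> (\<lambda>n. \<Sum>k=1..n. (lam k - lam j) * S j k) \<longlonglongrightarrow> \<alpha> j"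
    and second: "\<And>j. j \<in> {1..N} \<Longrightarrow> (\<lambda>n. \<Sum>k=1..n. (lam k - lam j)\<^sup>2 * S j k) \<longlonglongrightarrow> \<beta> j"
    and z: "lam N \<le> z" "z \<le> lam (N + 1)"
  shows "(\<Sum>j=1..N. (z - lam j)\<^sup>2 * \<alpha> j) \<le> (\<Sum>j=1..N. (z - lam j) * \<beta> j)"
proof -
  define T where "T j k = (z - lam j) * (lam k - lam j) * (z - lam k) * S j k" for j k
  have lim: "(\<lambda>n. \<Sum>j=1..N. (z - lam j)\<^sup>2 * (\<Sum>k=1..n. (lam k - lam j) * S j k)
        - (z - lam j) * (\<Sum>k=1..n. (lam k - lam j)\<^sup>2 * S j k))
      \<longlonglongrightarrow> (\<Sum>j=1..N. (z - lam j)\<^sup>2 * \<alpha> j - (z - lam j) * \<beta> j)"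
    by (intro tendsto_intros first second)
  have T: "(\<Sum>j=1..N. (z - lam j)\<^sup>2 * (\<Sum>k=1..n. (lam k - lam j) * S j k)
        - (z - lam j) * (\<Sum>k=1..n. (lam k - lam j)\<^sup>2 * S j k)) = (\<Sum>j=1..N. \<Sum>k=1..n. T j k)" for n
    by (simp add: T_def sum_distrib_left power2_eq_square algebra_simps flip: sum_subtractf)
  have le: "(\<Sum>j=1..N. \<Sum>k=1..n. T j k) \<le> 0" if "n \<ge> N" for n
  proof -
    have "(\<Sum>j=1..N. \<Sum>k=1..N. T j k) = (\<Sum>k=1..N. \<Sum>j=1..N. T j k)" by (rule sum.swap)
    also have "\<dots> = (\<Sum>k=1..N. \<Sum>j=1..N. - T k j)"
      by (intro sum.cong refl) (auto simp: T_def sym algebra_simps)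
    finally have anti: "(\<Sum>j=1..N. \<Sum>k=1..N. T j k) = 0" by (simp add: sum_negf)
    have "{1..n} = {1..N} \<union> {N+1..n}" "{1..N} \<inter> {N+1..n} = {}" using that by auto
    then have "(\<Sum>j=1..N. \<Sum>k=1..n. T j k)
        = (\<Sum>j=1..N. \<Sum>k=1..N. T j k) + (\<Sum>j=1..N. \<Sum>k=N+1..n. T j k)"
      by (simp add: sum.union_disjoint sum.distrib)
    also have "(\<Sum>j=1..N. \<Sum>k=N+1..n. T j k) \<le> 0"
    proof (intro sum_nonpos)
      fix j k assume jk: "j \<in> {1..N}" "k \<in> {N+1..n}"
      then have "0 \<le> z - lam j" "0 \<le> lam k - lam j" "z - lam k \<le> 0"
        using mono[of j N] mono[of j k] mono[of "N+1" k] z by auto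
      then show "T j k \<le> 0"
        unfolding T_def by (intro mult_nonpos_nonneg mult_nonneg_nonpos mult_nonneg_nonneg nonneg)
    qed
    finally show ?thesis unfolding anti by simp
  qed
  have "(\<Sum>j=1..N. (z - lam j)\<^sup>2 * \<alpha> j - (z - lam j) * \<beta> j) \<le> 0"
    by (rule LIMSEQ_le_const2[OF lim]) (use le in \<open>unfold T, blast\<close>)
  then show ?thesis by (simp add: sum_subtractf)
qed

lemma quadratic_bound:
  fixes z A C :: real
  assumes "z\<^sup>2 - 2 * A * z + C \<le> 0"
  shows "A\<^sup>2 - C \<ge> 0 \<and> z \<le> A + sqrt (A\<^sup>2 - C)"
proof -
  have "(z - A)\<^sup>2 \<le> A\<^sup>2 - C" using assms by (simp add: power2_eq_square algebra_simps)
  moreover from this have "z - A \<le> sqrt (A\<^sup>2 - C)" by (rule real_le_rsqrt)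
  moreover have "0 \<le> (z - A)\<^sup>2" by simp
  ultimately show ?thesis by linarith
qed

context torus_potential
begin

text \<open>The sum rules come from Parseval's identity in the eigenbasis: the squared matrix elements of
  \<open>G\<close>, weighted with the first and second power of \<open>\<lambda>\<^sub>k - \<lambda>\<^sub>j\<close>, sum to \<open>\<langle>\<phi>\<^sub>j, \<eta>\<rangle>\<close> and \<open>\<parallel>\<eta>\<parallel>\<^sup>2\<close>, where
  \<open>G \<eta>\<close> is the commutator applied to \<open>\<phi>\<^sub>j\<close>. Adding the contributions of \<open>t = q\<^sub>l\<close> and \<open>t = - q\<^sub>l\<close>, that is of \<open>G\<close> and
  its adjoint, serves two purposes: the weights become symmetric in \<open>j\<close> and \<open>k\<close>, and all terms of odd
  order in \<open>t\<close> cancel.\<close>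

lemma direction_inequality:
  assumes basis: "orthonormal_basis K \<phi>"
    and data: "\<And>j. j \<ge> 1 \<Longrightarrow> eigen_data K q V (lam j) (\<phi> j) (v j) (w j)"
    and mono: "\<And>j k. 1 \<le> j \<Longrightarrow> j \<le> k \<Longrightarrow> lam j \<le> lam k"
    and z: "lam N \<le> z" "z \<le> lam (N + 1)"
  shows "(\<Sum>j=1..N. (z - lam j)\<^sup>2) \<le> (\<Sum>j=1..N. (z - lam j) * ((q $ l)\<^sup>2 + 4 * normsq K (v j l)))"
proof -
  define t where "t = q $ l"
  have t: "t > 0" unfolding t_def by (rule q_pos)
  have lat: "axis l t \<in> dual_lattice q" "axis l (- t) \<in> dual_lattice q"
  proof -
    show "axis l t \<in> dual_lattice q" unfolding t_def by (rule dual_lattice_axis)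
    moreover have "axis l (- t) = - axis l t" by (simp add: axis_def vec_eq_iff)
    ultimately show "axis l (- t) \<in> dual_lattice q" by (simp only: dual_lattice_uminus)
  qed
  define G where "G s = wave (axis l s)" for s
  define \<eta> where "\<eta> s j x = of_real (s\<^sup>2) * \<phi> j x - 2 * \<i> * of_real s * v j l x" for s j x
  define A where "A s k j = L2_inner K (\<phi> k) (\<lambda>x. G s x * \<phi> j x)" for s k j
  define S where "S j k = (cmod (A t k j))\<^sup>2 + (cmod (A (-t) k j))\<^sup>2" for j k
  have phi: "\<phi> j \<in> L2 K" and vL2: "v j l \<in> L2 K" if "j \<ge> 1" for j
    using eigen_data_L2[OF data[OF that]] by auto
  have norm1: "L2_inner K (\<phi> j) (\<phi> j) = 1" if "j \<ge> 1" for j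
    using basis that by (simp add: orthonormal_basis_def)
  have \<eta>: "\<eta> s j \<in> L2 K" if "j \<ge> 1" for s j
    unfolding \<eta>_def using that by (intro L2_diff L2_cmult phi vL2)
  have GL2: "f \<in> L2 K \<Longrightarrow> (\<lambda>x. G s x * f x) \<in> L2 K" for f s
    unfolding G_def by (rule L2_wave_mult)
  have elem: "L2_inner K (\<phi> k) (\<lambda>x. G s x * \<eta> s j x) = of_real (lam k - lam j) * A s k j"
    if "j \<ge> 1" "k \<ge> 1" "axis l s \<in> dual_lattice q" for s j k
    unfolding A_def G_def \<eta>_def by (rule commutator_matrix_element[OF data[OF that(2)] data[OF that(1)] that(3), symmetric])
  have first: "(\<lambda>n. \<Sum>k=1..n. (lam k - lam j) * (cmod (A s k j))\<^sup>2)
      \<longlonglongrightarrow> Re (L2_inner K (\<phi> j) (\<eta> s j))"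
    if j: "j \<ge> 1" and s: "axis l s \<in> dual_lattice q" for s j
  proof -
    have "(\<lambda>n. Re (\<Sum>k=1..n. cnj (A s k j) * (of_real (lam k - lam j) * A s k j)))
        \<longlonglongrightarrow> Re (L2_inner K (\<lambda>x. G s x * \<phi> j x) (\<lambda>x. G s x * \<eta> s j x))"
    proof (rule tendsto_Re)
      have "cnj (A s k j) * (of_real (lam k - lam j) * A s k j)
          = cnj (A s k j) * L2_inner K (\<phi> k) (\<lambda>x. G s x * \<eta> s j x)" if "k \<in> {1..n}" for k n
        using elem[OF j _ s, of k] that by simp
      then show "(\<lambda>n. \<Sum>k=1..n. cnj (A s k j) * (of_real (lam k - lam j) * A s k j))
          \<longlonglongrightarrow> L2_inner K (\<lambda>x. G s x * \<phi> j x) (\<lambda>x. G s x * \<eta> s j x)"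
        using orthonormal_basis_Parseval[OF basis GL2[OF phi[OF j], of s] GL2[OF \<eta>[OF j, of s], of s]]
        by (simp only: A_def cong: sum.cong)
    qed
    moreover have "Re (cnj y * (of_real c * y)) = c * (cmod y)\<^sup>2" for y c
      unfolding cmod_power2 by (simp add: power2_eq_square algebra_simps)
    ultimately show ?thesis by (simp add: G_def L2_inner_wave_mult_both)
  qed
  have second: "(\<lambda>n. \<Sum>k=1..n. (lam k - lam j)\<^sup>2 * (cmod (A s k j))\<^sup>2) \<longlonglongrightarrow> normsq K (\<eta> s j)"
    if j: "j \<ge> 1" and s: "axis l s \<in> dual_lattice q" for s j
  proof -
    have "(\<lambda>n. Re (\<Sum>k=1..n. cnj (of_real (lam k - lam j) * A s k j) * (of_real (lam k - lam j) * A s k j)))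
        \<longlonglongrightarrow> Re (L2_inner K (\<lambda>x. G s x * \<eta> s j x) (\<lambda>x. G s x * \<eta> s j x))"
    proof (rule tendsto_Re)
      have "cnj (of_real (lam k - lam j) * A s k j) * (of_real (lam k - lam j) * A s k j)
          = cnj (L2_inner K (\<phi> k) (\<lambda>x. G s x * \<eta> s j x)) * L2_inner K (\<phi> k) (\<lambda>x. G s x * \<eta> s j x)"
        if "k \<in> {1..n}" for k n
        using elem[OF j _ s, of k] that by simp
      then show "(\<lambda>n. \<Sum>k=1..n. cnj (of_real (lam k - lam j) * A s k j) * (of_real (lam k - lam j) * A s k j))
          \<longlonglongrightarrow> L2_inner K (\<lambda>x. G s x * \<eta> s j x) (\<lambda>x. G s x * \<eta> s j x)"
        using orthonormal_basis_Parseval[OF basis GL2[OF \<eta>[OF j, of s], of s] GL2[OF \<eta>[OF j, of s], of s]]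
        by (simp only: cong: sum.cong)
    qed
    moreover have "Re (cnj (of_real c * y) * (of_real c * y)) = c\<^sup>2 * (cmod y)\<^sup>2" for y c
      unfolding cmod_power2 by (simp add: power2_eq_square algebra_simps)
    ultimately show ?thesis by (simp add: G_def L2_inner_wave_mult_both L2_inner_self)
  qed
  have alpha: "Re (L2_inner K (\<phi> j) (\<eta> t j)) + Re (L2_inner K (\<phi> j) (\<eta> (-t) j)) = 2 * t\<^sup>2"
    if "j \<ge> 1" for j
  proof -
    have "L2_inner K (\<phi> j) (\<eta> s j) = of_real (s\<^sup>2) - 2 * \<i> * of_real s * L2_inner K (\<phi> j) (v j l)" for s
      unfolding \<eta>_def using that
      by (simp only: L2_inner_diff_right phi vL2 L2_cmult L2_inner_cmult_right norm1 mult_1_right)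
    then show ?thesis by simp
  qed
  have beta: "normsq K (\<eta> t j) + normsq K (\<eta> (-t) j) = 2 * t\<^sup>2 * (t\<^sup>2 + 4 * normsq K (v j l))"
    if "j \<ge> 1" for j
  proof -
    have 1: "normsq K (\<phi> j) = 1" using norm1[OF that] by (simp add: L2_inner_self)
    have "normsq K (\<eta> s j) = s\<^sup>2 * s\<^sup>2 + 4 * s\<^sup>2 * normsq K (v j l)
        - 2 * s\<^sup>2 * s * Re (2 * \<i> * L2_inner K (\<phi> j) (v j l))" for s
    proof -
      have eq: "\<eta> s j = (\<lambda>x. of_real (s\<^sup>2) * \<phi> j x + (- 2 * \<i> * of_real s) * v j l x)"
        by (simp add: \<eta>_def fun_eq_iff)
      show ?thesis unfolding eq
        by (subst normsq_add)
          (simp_all only: L2_cmult phi vL2 that normsq_cmult L2_inner_cmult_left L2_inner_cmult_right 1,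
           simp add: norm_mult power_mult_distrib power2_eq_square algebra_simps)
    qed
    then show ?thesis by (simp add: power2_eq_square algebra_simps)
  qed
  have "(\<Sum>j=1..N. (z - lam j)\<^sup>2 * (2 * t\<^sup>2))
      \<le> (\<Sum>j=1..N. (z - lam j) * (2 * t\<^sup>2 * (t\<^sup>2 + 4 * normsq K (v j l))))"
  proof (rule symmetric_moment_inequality[where S=S, OF mono])
    have adj: "A (-s) k j = cnj (A s j k)" for s j k
    proof -
      have "axis l (- s) = - axis l s" by (simp add: axis_def vec_eq_iff)
      then have "cnj (\<phi> k x) * (G (-s) x * \<phi> j x) = cnj (G s x * \<phi> k x) * \<phi> j x" for x
        by (simp add: G_def cnj_wave mult_ac)
      then have "A (-s) k j = L2_inner K (\<lambda>x. G s x * \<phi> k x) (\<phi> j)"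
        unfolding A_def L2_inner_def by (simp only:)
      then show ?thesis by (simp add: A_def cnj_L2_inner)
    qed
    show "S j k = S k j" for j k
      using adj[of t k j] adj[of t j k] by (simp add: S_def)
    show "0 \<le> S j k" for j k by (simp add: S_def)
    fix j assume "j \<in> {1..N}"
    then have j: "j \<ge> 1" by simp
    show "(\<lambda>n. \<Sum>k=1..n. (lam k - lam j) * S j k) \<longlonglongrightarrow> 2 * t\<^sup>2"
      using tendsto_add[OF first[OF j lat(1)] first[OF j lat(2)]] unfolding alpha[OF j]
      by (simp add: S_def distrib_left sum.distrib)
    show "(\<lambda>n. \<Sum>k=1..n. (lam k - lam j)\<^sup>2 * S j k) \<longlonglongrightarrow> 2 * t\<^sup>2 * (t\<^sup>2 + 4 * normsq K (v j l))"
      using tendsto_add[OF second[OF j lat(1)] second[OF j lat(2)]] unfolding beta[OF j]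
      by (simp add: S_def distrib_left sum.distrib)
  qed (use z in auto)
  then have "(2 * t\<^sup>2) * (\<Sum>j=1..N. (z - lam j)\<^sup>2)
      \<le> (2 * t\<^sup>2) * (\<Sum>j=1..N. (z - lam j) * (t\<^sup>2 + 4 * normsq K (v j l)))"
    by (simp add: sum_distrib_left mult_ac)
  then show ?thesis using t by (simp add: t_def)
qed

text \<open>Summation over the coordinate directions turns the squared partial derivatives into the kinetic
  energy, and this equals \<open>\<lambda>\<^sub>j - V\<^sub>j\<close>.\<close>

lemma eigenvalue_quadratic_inequality:
  fixes N :: nat
  defines "d \<equiv> real CARD('n)"
  assumes basis: "orthonormal_basis K \<phi>"
    and eigen: "\<And>j. j \<ge> 1 \<Longrightarrow> schroedinger_per K q V (\<phi> j) (\<lambda>x. complex_of_real (lam j) * \<phi> j x)"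
    and mono: "\<And>j k. 1 \<le> j \<Longrightarrow> j \<le> k \<Longrightarrow> lam j \<le> lam k"
    and z: "lam N \<le> z" "z \<le> lam (N + 1)"
  shows "d * (\<Sum>j=1..N. (z - lam j)\<^sup>2) \<le> (\<Sum>j=1..N. (z - lam j) * ((\<Sum>i\<in>UNIV. (q $ i)\<^sup>2)
    + 4 * (lam j - Re (L2_inner K (\<phi> j) (\<lambda>x. complex_of_real (V x) * \<phi> j x)))))"
proof -
  have "\<exists>v w. eigen_data K q V (lam j) (\<phi> j) v w" if "j \<ge> 1" for j
    using schroedinger_eigen_data[OF eigen[OF that]] .
  then obtain v w where data: "\<And>j. j \<ge> 1 \<Longrightarrow> eigen_data K q V (lam j) (\<phi> j) (v j) (w j)"
    by metis
  have "d * (\<Sum>j=1..N. (z - lam j)\<^sup>2) = (\<Sum>l\<in>(UNIV :: 'n set). \<Sum>j=1..N. (z - lam j)\<^sup>2)"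
    by (simp add: d_def)
  also have "\<dots> \<le> (\<Sum>l\<in>UNIV. \<Sum>j=1..N. (z - lam j) * ((q $ l)\<^sup>2 + 4 * normsq K (v j l)))"
    by (intro sum_mono direction_inequality[OF basis data mono z])
  also have "\<dots> = (\<Sum>j=1..N. (z - lam j) * ((\<Sum>l\<in>UNIV. (q $ l)\<^sup>2) + 4 * (\<Sum>l\<in>UNIV. normsq K (v j l))))"
    by (subst sum.swap) (simp add: sum_distrib_left sum.distrib distrib_left)
  also have "\<dots> = (\<Sum>j=1..N. (z - lam j) * ((\<Sum>i\<in>UNIV. (q $ i)\<^sup>2)
    + 4 * (lam j - Re (L2_inner K (\<phi> j) (\<lambda>x. complex_of_real (V x) * \<phi> j x)))))"
  proof (rule sum.cong[OF refl])
    fix j assume "j \<in> {1..N}"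
    then have j: "j \<ge> 1" by simp
    then have "L2_inner K (\<phi> j) (\<phi> j) = 1" using basis by (simp add: orthonormal_basis_def)
    from kinetic_energy[OF data[OF j] this] show "(z - lam j) * ((\<Sum>l\<in>UNIV. (q $ l)\<^sup>2) + 4 * (\<Sum>l\<in>UNIV. normsq K (v j l)))
      = (z - lam j) * ((\<Sum>i\<in>UNIV. (q $ i)\<^sup>2)
        + 4 * (lam j - Re (L2_inner K (\<phi> j) (\<lambda>x. complex_of_real (V x) * \<phi> j x))))"
      by simp
  qed
  finally show ?thesis .
qed

end

section \<open>The eigenvalue bound\<close>

theorem mainTheorem4:
  fixes q a b :: "real ^ 'n"
    and K :: "(real ^ 'n) set"
    and V :: "real ^ 'n \<Rightarrow> real"
    and lam :: "nat \<Rightarrow> real"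
    and \<phi> :: "nat \<Rightarrow> real ^ 'n \<Rightarrow> complex"
    and N :: nat
  assumes q_pos: "\<And>i. q $ i > 0"
    and K_box: "K = cbox a b"
    and K_sides: "\<And>i. b $ i - a $ i = 2 * pi / q $ i"
    and V_measurable: "V \<in> borel_measurable lebesgue"
    and V_bounded: "bounded (range V)"
    and V_periodic: "periodic q V"
    and basis: "orthonormal_basis K \<phi>"
    and eigen: "\<And>j. j \<ge> 1 \<Longrightarrow>
      schroedinger_per K q V (\<phi> j) (\<lambda>x. complex_of_real (lam j) * \<phi> j x)"
    and ordered: "\<And>j. j \<ge> 1 \<Longrightarrow> lam j \<le> lam (j + 1)"
    and N: "N \<ge> 1"
  shows "let d = real CARD('n);
             g = (1 / d) * (\<Sum>i\<in>UNIV. (q $ i)\<^sup>2);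
             Vj = (\<lambda>j. Re (L2_inner K (\<phi> j) (\<lambda>x. complex_of_real (V x) * \<phi> j x)));
             avg_l = average N lam;
             avg_l2 = average N (\<lambda>j. (lam j)\<^sup>2);
             avg_V = average N Vj;
             avg_lV = average N (\<lambda>j. lam j * Vj j);
             D = ((1 + 2 / d) * avg_l + g / 2 - (2 / d) * avg_V)\<^sup>2
                 - (1 + 4 / d) * avg_l2 - g * avg_l + (4 / d) * avg_lV
         in D \<ge> 0 \<and>
            lam (N + 1) \<le> (1 + 2 / d) * avg_l + g / 2 - (2 / d) * avg_V + sqrt D"
proof -
  interpret torus_potential q a b K V
    by unfold_locales (fact q_pos K_box K_sides V_measurable V_bounded)+
  have mono: "lam j \<le> lam k" if "1 \<le> j" "j \<le> k" for j k
    using that(2,1)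
  proof (induction rule: dec_induct)
    case (step n)
    then show ?case using ordered[of n] by simp
  qed simp
  define d where "d = real CARD('n)"
  define g where "g = (1 / d) * (\<Sum>i\<in>UNIV. (q $ i)\<^sup>2)"
  define Vj where "Vj j = Re (L2_inner K (\<phi> j) (\<lambda>x. complex_of_real (V x) * \<phi> j x))" for j
  define z where "z = lam (N + 1)"
  define P where "P f = (\<Sum>j=1..N. f j :: real)" for f
  have d: "d > 0" by (simp add: d_def)
  \<comment> \<open>At \<open>z = lam (N + 1)\<close> the inequality says that a quadratic polynomial with discriminant \<open>4 * D\<close> is nonpositive.\<close>
  have "d * (\<Sum>j=1..N. (z - lam j)\<^sup>2) \<le> (\<Sum>j=1..N. (z - lam j) * (d * g + 4 * (lam j - Vj j)))"
    using eigenvalue_quadratic_inequality[OF basis eigen mono, of N z] mono[of N "N+1"] N d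
    by (simp add: d_def[symmetric] g_def Vj_def z_def)
  also have "(\<Sum>j=1..N. (z - lam j)\<^sup>2) = N * z\<^sup>2 - 2 * z * P lam + P (\<lambda>j. (lam j)\<^sup>2)"
    by (simp add: P_def power2_diff sum.distrib sum_subtractf sum_distrib_left algebra_simps)
  also have "(\<Sum>j=1..N. (z - lam j) * (d * g + 4 * (lam j - Vj j)))
      = N * z * d * g - d * g * P lam + 4 * z * P lam - 4 * z * P Vj
        - 4 * P (\<lambda>j. (lam j)\<^sup>2) + 4 * P (\<lambda>j. lam j * Vj j)"
    by (simp add: P_def sum.distrib sum_subtractf sum_distrib_left power2_eq_square algebra_simps)
  finally have ineq: "d * (N * z\<^sup>2 - 2 * z * P lam + P (\<lambda>j. (lam j)\<^sup>2))
      \<le> N * z * d * g - d * g * P lam + 4 * z * P lam - 4 * z * P Vj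
        - 4 * P (\<lambda>j. (lam j)\<^sup>2) + 4 * P (\<lambda>j. lam j * Vj j)" .
  have avg: "P f = N * average N f" for f using N by (simp add: P_def average_def)
  define A where "A = (1 + 2 / d) * average N lam + g / 2 - (2 / d) * average N Vj"
  define C where "C = (1 + 4 / d) * average N (\<lambda>j. (lam j)\<^sup>2) + g * average N lam
    - (4 / d) * average N (\<lambda>j. lam j * Vj j)"
  have "(N * d) * (z\<^sup>2 - 2 * A * z + C) \<le> 0"
  proof -
    have dA: "d * A = (d + 2) * average N lam + d * g / 2 - 2 * average N Vj"
      using d by (simp add: A_def field_simps)
    have dC: "d * C = (d + 4) * average N (\<lambda>j. (lam j)\<^sup>2) + d * g * average N lam
        - 4 * average N (\<lambda>j. lam j * Vj j)"
      using d by (simp add: C_def field_simps)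
    have "(N * d) * (z\<^sup>2 - 2 * A * z + C) = N * (d * z\<^sup>2 - 2 * z * (d * A) + d * C)"
      by (simp add: algebra_simps)
    then show ?thesis using ineq unfolding avg dA dC by (simp add: algebra_simps)
  qed
  then have "z\<^sup>2 - 2 * A * z + C \<le> 0"
    using N d by (simp add: mult_le_0_iff)
  from quadratic_bound[OF this] show ?thesis
    unfolding Let_def d_def[symmetric] g_def[symmetric] Vj_def[symmetric] z_def A_def C_def
    by (simp add: algebra_simps)
qed

end
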